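(* Let $p>3$ be a prime and $r\ge1$ an integer. Then $$\sum_{k=0}^{(p^r-1)/2}(4k+1)\frac{(\frac12)_k^4}{(1)_k^4}\equiv p^r+\frac76p^{r+3}B_{p-3}\pmod{p^{r+4}}.$$
   Context: $(x)_k=x(x+1)\cdots(x+k-1)$ is the Pochhammer symbol, with $(x)_0=1$. $B_0,B_1,B_2,\dots$ are the Bernoulli numbers. A congruence $a\equiv b\pmod{p^m}$ between rational numbers means that $(a-b)/p^m$ is a rational number whose denominator is not divisible by $p$. *)

theory Defs
  imports Complex_Main "HOL-Computational_Algebra.Primes"
begin

text \<open>Bernoulli numbers with the convention B_0 = 1, B_1 = -1/2, defined by the
  standard recurrence: for n >= 1, sum over j from 0 to n of (n+1 choose j) B_j = 0.\<close>
fun bernoulli :: "nat \<Rightarrow> rat" where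
  "bernoulli n = (if n = 0 then 1 else
     - (\<Sum>j<n. of_nat ((n + 1) choose j) * bernoulli j) / of_nat (n + 1))"

declare bernoulli.simps [simp del]

definition qcong :: "rat \<Rightarrow> rat \<Rightarrow> nat \<Rightarrow> nat \<Rightarrow> bool" where
  "qcong a b p m \<longleftrightarrow>
     \<not> (int p dvd snd (quotient_of ((a - b) / of_nat (p ^ m))))"

end

theory Submission
  imports Defs "HOL-Computational_Algebra.Polynomial" "HOL-Number_Theory.Residues"
begin

text \<open>
  Put \<open>n = p\<^sup>r\<close>, \<open>m = (n - 1) / 2\<close> and \<open>u\<^sub>k = ((1/2)\<^sub>k / k!)\<^sup>2\<close>. Telescoping turns the sum into
  \<open>n\<^sup>2 u\<^sub>m \<Sum> u\<^sub>k / (n - 2k)\<close>. Replacing \<open>u\<^sub>k\<close> by \<open>v\<^sub>k = (-1)\<^sup>k (m choose k) (m + k choose k)\<close>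
  makes this sum a partial fraction expansion with a product as its value, so that the original sum is
  \<open>n (\<Prod> (1 - n\<^sup>2/(4 j\<^sup>2)) + u\<^sub>m \<Sum> n/(n - 2k) (u\<^sub>k - v\<^sub>k))\<close>.
  Since \<open>u\<^sub>k - v\<^sub>k\<close> is divisible by \<open>p\<^sup>2\<close>, modulo \<open>p\<^sup>4\<close> only multiples of \<open>p\<close> contribute when \<open>r \<ge> 2\<close>,
  and both the product and the error term agree with those for \<open>r - 1\<close>.
  For \<open>r = 1\<close> the product is governed by \<open>\<Sum> 1/j\<^sup>2\<close> over \<open>j \<le> (p - 1)/2\<close>. The error term is \<open>p\<^sup>3/2\<close> times the
  linear coefficient of a polynomial of degree \<open>(p - 1)/2\<close> whose values at the nonzero squares modulo \<open>p\<close>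
  are harmonic numbers; interpolation turns it into a double harmonic sum, which reduces to \<open>B\<^sub>p\<^sub>-\<^sub>3\<close>.
\<close>

text \<open>The factor n in front supplies \<open>p ^ r\<close>, so the bracket matters only modulo
  p^4, whatever r is. The numbers v_k are the coefficients of the shifted Legendre polynomial of
  degree m: orthogonality gives their sum a closed form. They are also values of the same function
  of X, \<open>phi X k\<close>, as u_k: at X = n^2 instead of X = 0. The obstacle for r >= 2 is that
  \<open>phi X k\<close>, as a polynomial in X, has powers of p in the denominators of its
  coefficients once k >= p. Hence u_k - v_k cannot simply be expanded in powers of n^2; instead the
  factors divisible by p are split off (\<open>phi_factor\<close>) and consecutive exponents are
  compared. For r = 1 all indices are below p and the expansion to first order in X = p^2 is sound.
  Origin of 7/6: modulo p^4 the product contributes -7/12 and the error term 7/4 times p^3 B_{p-3}.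
  The latter is half of the double sum \<open>hconv\<close>, which is congruent to 7/2 B_{p-3}
  modulo p.\<close>

subsection \<open>Exact identities for the sum\<close>

text \<open>\<open>phi 0 k\<close> is the square of \<open>(1/2)\<^sub>k / k!\<close>, while \<open>phi ((2 * m + 1)\<^sup>2) k\<close> is
  \<open>(-1)\<^sup>k (m choose k) (m + k choose k)\<close>, which vanishes for \<open>k > m\<close>.\<close>

definition phi :: "rat \<Rightarrow> nat \<Rightarrow> rat" where
  "phi X k = (\<Prod>j=1..k. ((2 * of_nat j - 1)\<^sup>2 - X) / (2 * of_nat j)\<^sup>2)"

lemma phi_0 [simp]: "phi X 0 = 1"
  by (simp add: phi_def)

lemma phi_Suc: "phi X (Suc k) = phi X k * (((2 * of_nat k + 1)\<^sup>2 - X) / (2 * of_nat k + 2)\<^sup>2)"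
proof -
  have "2 * of_nat (Suc k) - 1 = (2 * of_nat k + 1 :: rat)" "2 * of_nat (Suc k) = (2 * of_nat k + 2 :: rat)"
    by simp_all
  then show ?thesis
    by (simp only: phi_def prod.cl_ivl_Suc) simp
qed

lemma pochhammer_power4: "pochhammer (1/2) k ^ 4 / pochhammer 1 k ^ 4 = (phi 0 k)\<^sup>2"
proof (induction k)
  case (Suc k)
  have "(1/2 + of_nat k :: rat) ^ 4 / (1 + of_nat k) ^ 4
      = (((2 * of_nat k + 1)\<^sup>2 - 0) / (2 * of_nat k + 2)\<^sup>2)\<^sup>2"
  proof -
    have "(1/2 + of_nat k :: rat) / (1 + of_nat k) = (2 * of_nat k + 1) / (2 * of_nat k + 2)"
      by (simp add: field_simps)
    then show ?thesis
      by (simp flip: power_divide power_mult)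
  qed
  then show ?case
    using Suc by (simp only: pochhammer_Suc phi_Suc power_mult_distrib flip: times_divide_times_eq)
qed auto

text \<open>A degenerate case of Whipple's transformation of a very-well-poised series into a balanced one.\<close>

lemma sum_telescoped:
  "(\<Sum>k\<le>m. of_nat (4 * k + 1) * (phi 0 k)\<^sup>2)
     = (2 * of_nat m + 1)\<^sup>2 * phi 0 m * (\<Sum>k\<le>m. phi 0 k / (2 * of_nat m - 2 * of_nat k + 1))"
proof (induction m)
  case (Suc m)
  define A where "A = (\<lambda>m. \<Sum>k\<le>m. phi 0 k / (2 * of_nat m - 2 * of_nat k + 1 :: rat))"
  define M where "M = (of_nat m :: rat)"
  \<comment> \<open>The creative-telescoping certificate for the summand
    \<open>phi 0 k / (2 * m - 2 * k + 1)\<close>. Its factor k^2 makes it vanish at k = 0, so the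
    sum of differences is just \<open>G (Suc m)\<close>.\<close>
  define G where "G = (\<lambda>k. - (4 * (of_nat k)\<^sup>2 * phi 0 k / (2 * M - 2 * of_nat k + 3)))"
  have M0: "M \<ge> 0" by (simp add: M_def)
  have tele: "(2 * M + 3)\<^sup>2 * (phi 0 k / (2 * M - 2 * of_nat k + 3))
      - (2 * M + 2)\<^sup>2 * (phi 0 k / (2 * M - 2 * of_nat k + 1)) = G (Suc k) - G k" if "k \<le> m" for k
  proof -
    define K where "K = (of_nat k :: rat)"
    have K: "0 \<le> K" "K \<le> M" using that by (simp_all add: K_def M_def)
    have d: "2 * M - 2 * K + 1 \<noteq> 0" "2 * M - 2 * K + 3 \<noteq> 0" "2 * K + 2 \<noteq> 0" "K + 1 \<noteq> 0"
      using K by linarith+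
    have "G (Suc k) = - ((2 * K + 1)\<^sup>2 * phi 0 k / (2 * M - 2 * K + 1))"
    proof -
      have "2 * M - 2 * (K + 1) + 3 = 2 * M - 2 * K + 1" by simp
      moreover have "(2 * K + 2)\<^sup>2 = 4 * (K + 1)\<^sup>2" by (simp add: power2_eq_square algebra_simps)
      ultimately show ?thesis
        using d by (simp add: G_def phi_Suc add.commute flip: K_def)
    qed
    moreover have "(2 * M + 3)\<^sup>2 * (phi 0 k / (2 * M - 2 * K + 3))
      - (2 * M + 2)\<^sup>2 * (phi 0 k / (2 * M - 2 * K + 1))
      = - ((2 * K + 1)\<^sup>2 * phi 0 k / (2 * M - 2 * K + 1)) - - (4 * K\<^sup>2 * phi 0 k / (2 * M - 2 * K + 3))"
      using d by (simp add: divide_simps) (simp add: power2_eq_square algebra_simps)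
    ultimately show ?thesis
      by (simp add: G_def flip: K_def)
  qed
  have "(\<Sum>k\<le>m. G (Suc k) - G k) = G (Suc m)"
    using sum_lessThan_telescope[of G "Suc m"] by (simp add: lessThan_Suc_atMost) (simp add: G_def)
  moreover have "A (Suc m) = phi 0 (Suc m) + (\<Sum>k\<le>m. phi 0 k / (2 * M - 2 * of_nat k + 3))"
    by (simp add: A_def M_def algebra_simps)
  moreover have "(\<Sum>k\<le>m. G (Suc k) - G k)
      = (2 * M + 3)\<^sup>2 * (\<Sum>k\<le>m. phi 0 k / (2 * M - 2 * of_nat k + 3)) - (2 * M + 2)\<^sup>2 * A m"
    unfolding A_def sum_distrib_left sum_subtractf[symmetric] M_def[symmetric]
    by (intro sum.cong refl) (simp add: tele[symmetric])
  ultimately have "(2 * M + 3)\<^sup>2 * A (Suc m) - (2 * M + 2)\<^sup>2 * A m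
      = (2 * M + 3)\<^sup>2 * phi 0 (Suc m) + G (Suc m)"
    by (simp add: algebra_simps)
  also have "G (Suc m) = - ((2 * M + 2)\<^sup>2 * phi 0 (Suc m))"
    by (simp add: G_def power2_eq_square algebra_simps flip: M_def)
  finally have rec: "(2 * M + 3)\<^sup>2 * A (Suc m)
      = (2 * M + 2)\<^sup>2 * A m + (4 * M + 5) * phi 0 (Suc m)"
    by (simp add: power2_eq_square algebra_simps)
  \<comment> \<open>This ratio explains the prefactor in the statement: multiplied by
    \<open>phi 0 (Suc m)\<close>, the coefficient of \<open>A m\<close> in \<open>rec\<close>
    becomes the prefactor for \<open>m\<close>, and what is left is exactly the next term of the
    left-hand sum.\<close>
  have "2 * M + 2 \<noteq> 0" using M0 by linarith
  then have step: "(2 * M + 2)\<^sup>2 * phi 0 (Suc m) = (2 * M + 1)\<^sup>2 * phi 0 m"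
    by (simp add: phi_Suc flip: M_def)
  have "(2 * M + 3)\<^sup>2 * phi 0 (Suc m) * A (Suc m)
     = phi 0 (Suc m) * ((2 * M + 2)\<^sup>2 * A m + (4 * M + 5) * phi 0 (Suc m))"
    unfolding rec[symmetric] by (simp add: mult_ac)
  also have "\<dots> = (2 * M + 1)\<^sup>2 * phi 0 m * A m + (4 * M + 5) * (phi 0 (Suc m))\<^sup>2"
    unfolding step[symmetric] by (simp add: power2_eq_square algebra_simps)
  finally show ?case
    using Suc by (simp add: A_def algebra_simps flip: M_def)
qed simp

section \<open>Values of \<open>phi\<close> at odd squares: contiguity and partial fractions\<close>

lemma phi_odd_Suc: "phi ((2 * a + 1)\<^sup>2) (Suc k)
   = phi ((2 * a + 1)\<^sup>2) k * ((of_nat k - a) * (of_nat k + 1 + a) / (of_nat k + 1)\<^sup>2)"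
proof -
  have "((2 * of_nat k + 1)\<^sup>2 - (2 * a + 1)\<^sup>2) = 4 * ((of_nat k - a) * (of_nat k + 1 + a))"
    "(2 * of_nat k + 2)\<^sup>2 = 4 * (of_nat k + 1 :: rat)\<^sup>2"
    by (simp_all add: power2_eq_square algebra_simps)
  then show ?thesis
    by (simp only: phi_Suc mult_divide_mult_cancel_left)
qed

lemma phi_odd_eq_0: "M < k \<Longrightarrow> phi ((2 * of_nat M + 1)\<^sup>2) k = 0"
  by (auto simp: phi_def intro!: bexI[of _ "Suc M"] simp: algebra_simps)

text \<open>Up to sign, \<open>phi\<close> at (2M+1)^2 is (M+k)! / (k!^2 (M-k)!) for k <= M, and
  passing from M to M - 1 multiplies this by (M-k)/(M+k). Both inductions on the degree
  \<open>m\<close> below rest on this.\<close>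

lemma phi_step:
  assumes "M > 0"
  shows "phi ((2 * of_nat M - 1)\<^sup>2) k * (of_nat M + of_nat k) = phi ((2 * of_nat M + 1)\<^sup>2) k * (of_nat M - of_nat k)"
proof (induction k)
  case (Suc k)
  have "(2 * of_nat M - 1 :: rat) = 2 * (of_nat M - 1) + 1" by simp
  note a = phi_odd_Suc[of "of_nat M - 1 :: rat", folded this]
  let ?q = "1 / (of_nat k + 1 :: rat)\<^sup>2"
  have "phi ((2 * of_nat M - 1)\<^sup>2) (Suc k) * (of_nat M + of_nat (Suc k))
     = (phi ((2 * of_nat M - 1)\<^sup>2) k * (of_nat M + of_nat k))
         * ((of_nat k - (of_nat M - 1)) * (of_nat M + of_nat (Suc k)) * ?q)"
    unfolding a by (simp add: add.commute)
  also have "\<dots> = phi ((2 * of_nat M + 1)\<^sup>2) (Suc k) * (of_nat M - of_nat (Suc k))"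
    unfolding Suc phi_odd_Suc by (simp add: divide_simps) (simp add: algebra_simps)
  finally show ?case .
qed simp

lemma phi_pred:
  assumes "M > 0"
  shows "phi ((2 * of_nat M - 1)\<^sup>2) k
     = phi ((2 * of_nat M + 1)\<^sup>2) k * (of_nat M - of_nat k) / (of_nat M + of_nat k)"
proof -
  have "of_nat M + of_nat k \<noteq> (0 :: rat)"
    using assms by (simp add: add_nonneg_eq_0_iff)
  then show ?thesis
    using phi_step[OF assms, of k] by (simp add: eq_divide_eq)
qed

text \<open>The summand is Gosper-summable; the factor \<open>M - K\<close> makes the full sum
  vanish.\<close>

lemma sum_phi_partial:
  assumes "M > 0"
  shows "(\<Sum>k\<le>K. phi ((2 * of_nat M + 1)\<^sup>2) k / (of_nat M + of_nat k))
     = phi ((2 * of_nat M + 1)\<^sup>2) K * (of_nat M - of_nat K) / (of_nat M)\<^sup>2"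
proof (induction K)
  case 0
  then show ?case using assms by (simp add: power2_eq_square)
next
  case (Suc K)
  have nz: "(of_nat M :: rat) \<noteq> 0" "of_nat M + of_nat K + 1 \<noteq> (0::rat)" "of_nat K + 1 \<noteq> (0::rat)"
    using assms by (simp_all add: add_nonneg_eq_0_iff)
  show ?case
    unfolding sum.atMost_Suc Suc phi_odd_Suc
    using nz by (simp add: divide_simps add_ac) (simp add: power2_eq_square algebra_simps)
qed

text \<open>Orthogonality of the shifted Legendre polynomial of degree M to x^(M-1) on the unit
  interval, written in coefficients.\<close>

lemma sum_phi_eq_0:
  assumes "M > 0"
  shows "(\<Sum>k\<le>M. phi ((2 * of_nat M + 1)\<^sup>2) k / (of_nat M + of_nat k)) = 0"
  using sum_phi_partial[OF assms, of M] by simp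

definition hs :: "nat \<Rightarrow> nat \<Rightarrow> rat" where
  "hs e m = (\<Sum>j=1..m. 1 / of_nat j ^ e)"

lemma hs_0 [simp]: "hs e 0 = 0"
  by (simp add: hs_def)

lemma hs_Suc: "hs e (Suc m) = hs e m + 1 / of_nat (Suc m) ^ e"
  by (simp add: hs_def)

text \<open>Partial fractions in z: the right-hand side has simple poles at z = -k, with the values
  of \<open>phi\<close> as residues.\<close>

lemma sum_phi_over_shift:
  assumes z: "\<And>k. z + of_nat k \<noteq> 0"
  shows "(\<Sum>k\<le>m. phi ((2 * of_nat m + 1)\<^sup>2) k / (z + of_nat k))
     = (\<Prod>j=1..m. of_nat j - z) / (\<Prod>j\<le>m. z + of_nat j)"
proof (induction m)
  case (Suc m)
  define M where "M = (of_nat (Suc m) :: rat)"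
  have M: "2 * of_nat m + 1 = 2 * M - 1" "2 * of_nat (Suc m) + 1 = 2 * M + 1" and M0: "M > 0"
    by (simp_all add: M_def)
  let ?v = "phi ((2 * M + 1)\<^sup>2)" and ?w = "phi ((2 * M - 1)\<^sup>2)"
  \<comment> \<open>The combination of degrees m + 1 and m is chosen so that z + k cancels; what
    remains is the sum that orthogonality annihilates.\<close>
  have step: "(z + M) * (?v k / (z + of_nat k)) - (M - z) * (?w k / (z + of_nat k))
      = 2 * M * (?v k / (M + of_nat k))" for k
  proof -
    have Mk: "M + of_nat k \<noteq> 0" using M0 by (simp add: add_nonneg_eq_0_iff)
    have w: "?w k = ?v k * (M - of_nat k) / (M + of_nat k)"
      unfolding M_def by (intro phi_pred) simp
    show ?thesis unfolding w using Mk z[of k]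
      by (simp add: divide_simps) (simp add: algebra_simps)
  qed
  have "(z + M) * (\<Sum>k\<le>Suc m. ?v k / (z + of_nat k)) - (M - z) * (\<Sum>k\<le>Suc m. ?w k / (z + of_nat k))
     = 2 * M * (\<Sum>k\<le>Suc m. ?v k / (M + of_nat k))"
    unfolding sum_distrib_left sum_subtractf[symmetric] step ..
  also have "\<dots> = 0"
    using sum_phi_eq_0[of "Suc m"] unfolding M_def by simp
  finally have "(z + M) * (\<Sum>k\<le>Suc m. ?v k / (z + of_nat k)) = (M - z) * (\<Sum>k\<le>m. ?w k / (z + of_nat k))"
    using phi_odd_eq_0[of m "Suc m"] unfolding M by simp
  also have "(\<Sum>k\<le>m. ?w k / (z + of_nat k)) = (\<Prod>j=1..m. of_nat j - z) / (\<Prod>j\<le>m. z + of_nat j)"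
    using Suc.IH unfolding M .
  also have "(M - z) * \<dots> = (\<Prod>j=1..Suc m. of_nat j - z) / (\<Prod>j\<le>m. z + of_nat j)"
    by (simp add: M_def)
  finally have "(\<Sum>k\<le>Suc m. ?v k / (z + of_nat k))
     = (\<Prod>j=1..Suc m. of_nat j - z) / (\<Prod>j\<le>m. z + of_nat j) / (z + M)"
    using z[of "Suc m"] by (metis M_def nonzero_mult_div_cancel_left)
  then show ?case
    unfolding M(2) by (simp only: M_def prod.atMost_Suc divide_divide_eq_left)
qed simp

text \<open>The limit z -> 0 of the partial fractions without their k = 0 term 1/z: the linear
  coefficient in z of the product of (1 - z/j)/(1 + z/j) is -2 H_m.\<close>

lemma sum_phi_over_index: "(\<Sum>k=1..m. phi ((2 * of_nat m + 1)\<^sup>2) k / of_nat k) = - 2 * hs 1 m"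
proof (induction m)
  case (Suc m)
  define M where "M = (of_nat (Suc m) :: rat)"
  have M: "2 * of_nat m + 1 = 2 * M - 1" "2 * of_nat (Suc m) + 1 = 2 * M + 1" and M0: "M > 0"
    by (simp_all add: M_def)
  let ?v = "phi ((2 * M + 1)\<^sup>2)" and ?w = "phi ((2 * M - 1)\<^sup>2)"
  have step: "?v k / of_nat k - ?w k / of_nat k = 2 * (?v k / (M + of_nat k))" if "k \<ge> 1" for k
  proof -
    have Mk: "M + of_nat k \<noteq> 0" using M0 by (simp add: add_nonneg_eq_0_iff)
    have "?w k = ?v k * (M - of_nat k) / (M + of_nat k)"
      unfolding M_def by (intro phi_pred) simp
    then show ?thesis using Mk that
      by (simp add: divide_simps) (simp add: algebra_simps)
  qed
  have "0 = (\<Sum>k\<le>Suc m. ?v k / (M + of_nat k))"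
    using sum_phi_eq_0[of "Suc m"] unfolding M_def by (metis zero_less_Suc)
  also have "{..Suc m} = insert 0 {1..Suc m}" by auto
  finally have "(\<Sum>k=1..Suc m. ?v k / (M + of_nat k)) = - 1 / M"
    by (simp add: algebra_simps add_eq_0_iff)
  moreover have "(\<Sum>k=1..Suc m. ?v k / of_nat k) - (\<Sum>k=1..Suc m. ?w k / of_nat k)
     = 2 * (\<Sum>k=1..Suc m. ?v k / (M + of_nat k))"
    unfolding sum_distrib_left sum_subtractf[symmetric] by (intro sum.cong refl step) auto
  moreover have "(\<Sum>k=1..Suc m. ?w k / of_nat k) = (\<Sum>k=1..m. ?w k / of_nat k)"
    using phi_odd_eq_0[of m "Suc m"] unfolding M by simp
  ultimately show ?case
    using Suc.IH unfolding M hs_Suc M_def[symmetric] by simp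
qed simp

text \<open>Reversing the order of the numerators replaces 2j - 1 by n - 2j.\<close>

lemma phi_0_reflect:
  assumes "n = 2 * m + 1"
  shows "phi 0 m = (\<Prod>j=1..m. (1 - of_nat n / (2 * of_nat j))\<^sup>2)"
proof -
  have "phi 0 m = (\<Prod>j=1..m. (2 * of_nat (m + 1 - j) - 1)\<^sup>2) / (\<Prod>j=1..m. (2 * of_nat j)\<^sup>2)"
    unfolding phi_def prod_dividef
    by (subst prod.atLeastAtMost_rev) simp
  also have "(\<Prod>j=1..m. (2 * of_nat (m + 1 - j) - 1 :: rat)\<^sup>2) = (\<Prod>j=1..m. (2 * of_nat j - of_nat n)\<^sup>2)"
  proof (intro prod.cong refl)
    fix j assume "j \<in> {1..m}"
    then have "2 * of_nat (m + 1 - j) - 1 = - (2 * of_nat j - of_nat n :: rat)"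
      by (simp add: assms of_nat_diff algebra_simps)
    then show "(2 * of_nat (m + 1 - j) - 1 :: rat)\<^sup>2 = (2 * of_nat j - of_nat n)\<^sup>2"
      by (simp only: power2_minus)
  qed
  also have "\<dots> / (\<Prod>j=1..m. (2 * of_nat j)\<^sup>2) = (\<Prod>j=1..m. (1 - of_nat n / (2 * of_nat j))\<^sup>2)"
    unfolding prod_dividef[symmetric] power_divide[symmetric]
    by (intro prod.cong refl) (simp add: diff_divide_distrib)
  finally show ?thesis .
qed

text \<open>The partial fractions at z = -n/2, which is no pole because n is odd. With x = n/(2j)
  each factor becomes (1-x)^2 (1+x)/(1-x) = 1 - x^2.\<close>

lemma phi_square_product:
  assumes "n = 2 * m + 1"
  shows "phi 0 m * (\<Sum>k\<le>m. of_nat n / (of_nat n - 2 * of_nat k) * phi ((of_nat n)\<^sup>2) k)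
     = (\<Prod>j=1..m. 1 - (of_nat n / (2 * of_nat j))\<^sup>2)"
proof -
  define N where "N = (of_nat n :: rat)"
  have N: "N = 2 * of_nat m + 1" and N0: "N > 0" by (simp_all add: N_def assms)
  have odd: "N \<noteq> 2 * of_nat k" for k
  proof
    assume "N = 2 * of_nat k"
    then have "of_nat n = (of_nat (2 * k) :: rat)" by (simp add: N_def)
    then have "n = 2 * k" by (simp only: of_nat_eq_iff)
    with assms show False by presburger
  qed
  have z: "- N / 2 + of_nat k \<noteq> 0" for k
    using odd[of k] by (simp add: field_simps)
  have "(\<Sum>k\<le>m. N / (N - 2 * of_nat k) * phi (N\<^sup>2) k)
      = - (N / 2) * (\<Sum>k\<le>m. phi (N\<^sup>2) k / (- N / 2 + of_nat k))"
    unfolding sum_distrib_left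
  proof (intro sum.cong refl)
    fix k
    show "N / (N - 2 * of_nat k) * phi (N\<^sup>2) k = - (N / 2) * (phi (N\<^sup>2) k / (- N / 2 + of_nat k))"
      using odd[of k] z[of k] by (simp add: divide_simps) (simp add: algebra_simps)
  qed
  also have "\<dots> = - (N / 2) * ((\<Prod>j=1..m. of_nat j + N / 2) / (\<Prod>j\<le>m. - N / 2 + of_nat j))"
    using sum_phi_over_shift[OF z, of m] by (simp flip: N)
  also have "(\<Prod>j\<le>m. - N / 2 + of_nat j) = (- N / 2) * (\<Prod>j=1..m. - N / 2 + of_nat j)"
    by (simp add: prod.atLeast_Suc_atMost flip: atLeast0AtMost)
  also have "- (N / 2) * ((\<Prod>j=1..m. of_nat j + N / 2) / ((- N / 2) * (\<Prod>j=1..m. - N / 2 + of_nat j)))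
     = (\<Prod>j=1..m. (of_nat j + N / 2) / (- N / 2 + of_nat j))"
    using N0 by (simp add: prod_dividef)
  finally have *: "(\<Sum>k\<le>m. N / (N - 2 * of_nat k) * phi (N\<^sup>2) k) = \<dots>" .
  have "phi 0 m * (\<Sum>k\<le>m. N / (N - 2 * of_nat k) * phi (N\<^sup>2) k)
    = (\<Prod>j=1..m. (1 - N / (2 * of_nat j))\<^sup>2 * ((of_nat j + N / 2) / (- N / 2 + of_nat j)))"
    unfolding * phi_0_reflect[OF assms] N_def[symmetric] by (simp only: prod.distrib)
  also have "\<dots> = (\<Prod>j=1..m. 1 - (N / (2 * of_nat j))\<^sup>2)"
  proof (intro prod.cong refl)
    fix j assume "j \<in> {1..m}"
    then show "(1 - N / (2 * of_nat j))\<^sup>2 * ((of_nat j + N / 2) / (- N / 2 + of_nat j))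
        = 1 - (N / (2 * of_nat j))\<^sup>2"
      using odd[of j] z[of j] by (simp add: divide_simps) (simp add: power2_eq_square algebra_simps)
  qed
  finally show ?thesis by (simp add: N_def)
qed

lemma sum_decomposition:
  assumes "n = 2 * m + 1"
  shows "(\<Sum>k\<le>m. of_nat (4 * k + 1) * (phi 0 k)\<^sup>2)
     = of_nat n * ((\<Prod>j=1..m. 1 - (of_nat n / (2 * of_nat j))\<^sup>2)
         + phi 0 m * (\<Sum>k\<le>m. of_nat n / (of_nat n - 2 * of_nat k) * (phi 0 k - phi ((of_nat n)\<^sup>2) k)))"
proof -
  have "(\<Sum>k\<le>m. of_nat (4 * k + 1) * (phi 0 k)\<^sup>2)
     = of_nat n * (phi 0 m * (\<Sum>k\<le>m. of_nat n / (of_nat n - 2 * of_nat k) * phi 0 k))"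
  proof -
    have n: "2 * of_nat m + 1 = (of_nat n :: rat)" by (simp add: assms)
    have "(\<Sum>k\<le>m. phi 0 k / (2 * of_nat m - 2 * of_nat k + 1)) = (\<Sum>k\<le>m. phi 0 k / (of_nat n - 2 * of_nat k))"
      by (simp add: algebra_simps flip: n)
    then show ?thesis
      unfolding sum_telescoped n by (simp add: power2_eq_square sum_distrib_left mult_ac)
  qed
  then show ?thesis
    unfolding phi_square_product[OF assms, symmetric]
    by (simp add: right_diff_distrib sum_subtractf flip: distrib_left)
qed

subsection \<open>Bernoulli numbers and harmonic sums\<close>

lemma bernoulli_sum: "(\<Sum>i<n. of_nat (n choose i) * bernoulli i) = (if n = 1 then 1 else 0)"
proof -
  consider "n = 0" | "n = 1" | k where "n = Suc (Suc k)" by (metis One_nat_def nat.exhaust)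
  then show ?thesis
  proof cases
    case 3
    have "bernoulli (Suc k) = - (\<Sum>j<Suc k. of_nat (n choose j) * bernoulli j) / of_nat n"
      using bernoulli.simps[of "Suc k"] 3 by simp
    then show ?thesis using 3
      by (simp add: field_simps del: of_nat_Suc)
  qed (simp_all add: bernoulli.simps[of 0])
qed

text \<open>Both sides have the same increment in N: after exchanging sums and regrouping binomials,
  \<open>bernoulli_sum\<close> kills every coefficient of the increment except that of N^s.\<close>

lemma faulhaber:
  "of_nat (s + 1) * (\<Sum>t<N. of_nat t ^ s)
     = (\<Sum>i\<le>s. of_nat ((s + 1) choose i) * bernoulli i * of_nat N ^ (s + 1 - i))"
proof (induction N)
  case (Suc N)
  let ?n = "s + 1" and ?x = "of_nat N :: rat"
  have "(\<Sum>i\<le>s. of_nat (?n choose i) * bernoulli i * (1 + ?x) ^ (?n - i))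
      - (\<Sum>i\<le>s. of_nat (?n choose i) * bernoulli i * ?x ^ (?n - i))
      = (\<Sum>i\<le>s. \<Sum>l<?n - i. of_nat (?n choose i) * bernoulli i * (of_nat (?n - i choose l) * ?x ^ l))"
    unfolding sum_subtractf[symmetric]
  proof (intro sum.cong refl)
    fix i
    have "(1 + ?x) ^ (?n - i) - ?x ^ (?n - i) = (\<Sum>l<?n - i. of_nat (?n - i choose l) * ?x ^ l)"
      using binomial_ring[of ?x 1 "?n - i"] by (simp add: add.commute lessThan_Suc_atMost[symmetric])
    then show "of_nat (?n choose i) * bernoulli i * (1 + ?x) ^ (?n - i)
        - of_nat (?n choose i) * bernoulli i * ?x ^ (?n - i)
       = (\<Sum>l<?n - i. of_nat (?n choose i) * bernoulli i * (of_nat (?n - i choose l) * ?x ^ l))"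
      by (simp only: sum_distrib_left[symmetric] right_diff_distrib[symmetric])
  qed
  also have "\<dots> = (\<Sum>l\<le>s. \<Sum>i<?n - l. of_nat (?n choose i) * bernoulli i * (of_nat (?n - i choose l) * ?x ^ l))"
    unfolding sum.Sigma[OF finite_atMost ballI[OF finite_lessThan]]
    by (rule sum.reindex_bij_witness[of _ "\<lambda>(a, b). (b, a)" "\<lambda>(a, b). (b, a)"]) auto
  also have "\<dots> = (\<Sum>l\<le>s. of_nat (?n choose l) * ?x ^ l * (\<Sum>i<?n - l. of_nat (?n - l choose i) * bernoulli i))"
    unfolding sum_distrib_left
  proof (intro sum.cong refl)
    fix l i assume li: "l \<in> {..s}" "i \<in> {..<?n - l}"
    have "(?n choose i) * (?n - i choose l) = (?n choose l) * (?n - l choose i)"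
    proof -
      have "(?n choose (i + l)) * ((i + l) choose i) = (?n choose i) * (?n - i choose l)"
        using li choose_mult[of i "i + l" ?n] by auto
      moreover have "(?n choose (i + l)) * ((i + l) choose l) = (?n choose l) * (?n - l choose i)"
        using li choose_mult[of l "i + l" ?n] by auto
      moreover have "(i + l) choose i = (i + l) choose l"
        by (metis add.commute binomial_symmetric diff_add_inverse le_add1)
      ultimately show ?thesis by metis
    qed
    then have *: "of_nat (?n choose i) * of_nat (?n - i choose l) = (of_nat (?n choose l) * of_nat (?n - l choose i) :: rat)"
      by (metis of_nat_mult)
    have "of_nat (?n choose i) * bernoulli i * (of_nat (?n - i choose l) * ?x ^ l)
       = (of_nat (?n choose i) * of_nat (?n - i choose l)) * (bernoulli i * ?x ^ l)"
      by (simp only: mult_ac)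
    also have "\<dots> = of_nat (?n choose l) * ?x ^ l * (of_nat (?n - l choose i) * bernoulli i)"
      unfolding * by (simp only: mult_ac)
    finally show "of_nat (?n choose i) * bernoulli i * (of_nat (?n - i choose l) * ?x ^ l)
       = of_nat (?n choose l) * ?x ^ l * (of_nat (?n - l choose i) * bernoulli i)" .
  qed
  also have "\<dots> = (\<Sum>l\<le>s. if l = s then of_nat ?n * ?x ^ s else 0)"
    unfolding bernoulli_sum by (intro sum.cong refl) (auto simp: of_nat_add)
  also have "\<dots> = of_nat ?n * ?x ^ s"
    by simp
  finally show ?case
    using Suc by (simp only: sum.lessThan_Suc of_nat_Suc distrib_left)
next
  case 0
  show ?case by (auto simp: Suc_diff_le intro!: sum.neutral)
qed

section \<open>Truncated double harmonic sums\<close>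

definition hs12 :: "nat \<Rightarrow> rat" where
  "hs12 n = (\<Sum>b=1..n. hs 1 (b - 1) / of_nat b ^ 2)"

definition hs21 :: "nat \<Rightarrow> rat" where
  "hs21 n = (\<Sum>b=1..n. hs 2 (b - 1) / of_nat b)"

text \<open>The sum of 1/(i^2 j) over positive i, j with i + j <= n.\<close>

definition hconv :: "nat \<Rightarrow> rat" where
  "hconv n = (\<Sum>i=1..n. hs 1 (n - i) / of_nat i ^ 2)"

text \<open>Stuffle product: the pairs of indices in the product on the right are split by which
  index is larger; the diagonal gives \<open>hs 3 n\<close>.\<close>

lemma hs_stuffle: "hs12 n + hs21 n + hs 3 n = hs 1 n * hs 2 n"
proof (induction n)
  case (Suc n)
  define x :: rat where "x = 1 / of_nat (Suc n)"
  have "hs12 (Suc n) = hs12 n + hs 1 n * x ^ 2" "hs21 (Suc n) = hs21 n + hs 2 n * x"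
    by (simp_all add: hs12_def hs21_def x_def power_divide)
  moreover have "hs e (Suc n) = hs e n + x ^ e" for e
    by (simp add: hs_Suc x_def power_divide)
  ultimately show ?case using Suc
    by (simp add: algebra_simps power2_eq_square power3_eq_cube)
qed (simp add: hs12_def hs21_def)

text \<open>Shuffle counterpart: raising n to N - 1 + 1 = N adds the antidiagonal i + j = N, where
  1/((N-i) i^2) splits into partial fractions. The two parts with 1/N^2 have equal sums, hence the
  coefficient 2.\<close>

lemma hconv_eq: "hconv n = 2 * hs12 n + hs21 n"
proof (induction n)
  case (Suc n)
  define N :: rat where "N = of_nat (Suc n)"
  have N0: "N \<noteq> 0" by (simp add: N_def)
  have "hconv (Suc n) = (\<Sum>i=1..n. hs 1 (Suc n - i) / of_nat i ^ 2)"
    by (simp add: hconv_def)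
  also have "\<dots> = (\<Sum>i=1..n. hs 1 (n - i) / of_nat i ^ 2 + 1 / ((N - of_nat i) * of_nat i ^ 2))"
  proof (intro sum.cong refl)
    fix i assume "i \<in> {1..n}"
    then have "Suc n - i = Suc (n - i)" "of_nat (Suc (n - i)) = N - of_nat i"
      by (auto simp: N_def of_nat_diff)
    then show "hs 1 (Suc n - i) / of_nat i ^ 2 = hs 1 (n - i) / of_nat i ^ 2 + 1 / ((N - of_nat i) * of_nat i ^ 2)"
      by (simp add: hs_Suc add_divide_distrib)
  qed
  also have "\<dots> = hconv n + (\<Sum>i=1..n. 1 / ((N - of_nat i) * of_nat i ^ 2))"
    by (simp add: hconv_def sum.distrib)
  also have "(\<Sum>i=1..n. 1 / ((N - of_nat i) * of_nat i ^ 2))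
     = (\<Sum>i=1..n. (1 / (N - of_nat i)) / N ^ 2 + (1 / of_nat i) / N ^ 2 + (1 / of_nat i ^ 2) / N)"
  proof (intro sum.cong refl)
    fix i assume i: "i \<in> {1..n}"
    define x :: rat where "x = of_nat i"
    have "x \<noteq> 0" "N - x \<noteq> 0" using i by (auto simp: x_def N_def)
    then show "1 / ((N - of_nat i) * of_nat i ^ 2) = (1 / (N - of_nat i)) / N ^ 2 + (1 / of_nat i) / N ^ 2 + (1 / of_nat i ^ 2) / N"
      unfolding x_def[symmetric] using N0 by (simp add: divide_simps) (simp add: power2_eq_square algebra_simps)
  qed
  also have "\<dots> = (\<Sum>i=1..n. 1 / (N - of_nat i)) / N ^ 2 + hs 1 n / N ^ 2 + hs 2 n / N"
    by (simp add: sum.distrib hs_def sum_divide_distrib)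
  also have "(\<Sum>i=1..n. 1 / (N - of_nat i)) = hs 1 n"
  proof -
    have "hs 1 n = (\<Sum>i=1..n. 1 / of_nat (n + 1 - i))"
      unfolding hs_def by (subst sum.atLeastAtMost_rev) (simp add: add.commute)
    also have "\<dots> = (\<Sum>i=1..n. 1 / (N - of_nat i))"
      by (intro sum.cong refl) (auto simp: N_def of_nat_diff)
    finally show ?thesis ..
  qed
  finally show ?case
    using Suc by (simp add: hs12_def hs21_def N_def)
qed (simp add: hconv_def hs12_def hs21_def)

section \<open>\<open>phi X k\<close> as a polynomial in X\<close>

definition phi_poly :: "nat \<Rightarrow> rat poly" where
  "phi_poly k = (\<Prod>j=1..k. [: (of_nat (2 * j - 1))\<^sup>2 / (of_nat (2 * j))\<^sup>2, - 1 / (of_nat (2 * j))\<^sup>2 :])"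

lemma poly_phi_poly: "poly (phi_poly k) X = phi X k"
proof -
  have "poly [: (of_nat (2 * j - 1))\<^sup>2 / (of_nat (2 * j))\<^sup>2, - 1 / (of_nat (2 * j))\<^sup>2 :] X
     = ((2 * of_nat j - 1)\<^sup>2 - X) / (2 * of_nat j)\<^sup>2" if "j \<ge> 1" for j :: nat
    using that by (simp add: of_nat_diff diff_divide_distrib)
  then show ?thesis
    unfolding phi_poly_def phi_def poly_prod by (intro prod.cong refl) auto
qed

lemma degree_phi_poly: "degree (phi_poly k) \<le> k"
proof -
  have "degree (phi_poly k) \<le> sum (degree \<circ>
      (\<lambda>j. [: (of_nat (2 * j - 1))\<^sup>2 / (of_nat (2 * j))\<^sup>2, - 1 / (of_nat (2 * j))\<^sup>2 :] :: rat poly)) {1..k}"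
    unfolding phi_poly_def by (rule degree_prod_sum_le) simp
  also have "\<dots> \<le> (\<Sum>j=1..k. 1)"
    by (intro sum_mono) (auto simp: degree_pCons_eq_if)
  finally show ?thesis by simp
qed

lemma poly_altdef_le: "degree q \<le> n \<Longrightarrow> poly q x = (\<Sum>e\<le>n. Polynomial.coeff q e * x ^ e)" for x :: rat
  unfolding poly_altdef
  by (rule sum.mono_neutral_left) (auto simp: coeff_eq_0)

subsection \<open>Congruences between rational numbers\<close>

locale prime_gt_3 =
  fixes p :: nat
  assumes prime: "prime p" and gt_3: "p > 3"
begin

text \<open>The ideal \<open>p\<^sup>e \<int>\<^sub>(\<^sub>p\<^sub>)\<close> of the ring of \<open>p\<close>-integral rationals.\<close>

definition I :: "nat \<Rightarrow> rat set" where
  "I e = {of_nat p ^ e * (of_int a / of_int b) | a b. \<not> int p dvd b}"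

definition pcong :: "rat \<Rightarrow> nat \<Rightarrow> rat \<Rightarrow> bool" ("(_ \<cong>\<^bsub>_\<^esub> _)" [51, 0, 51] 50) where
  "x \<cong>\<^bsub>e\<^esub> y \<longleftrightarrow> x - y \<in> I e"

lemma prime_int: "prime (int p)"
  using prime by simp

lemma p_pos [simp]: "p > 0" "p \<noteq> 0"
  using gt_3 by simp_all

lemma II: "\<not> int p dvd b \<Longrightarrow> x = of_nat p ^ e * (of_int a / of_int b) \<Longrightarrow> x \<in> I e"
  by (auto simp: I_def)

lemma IE:
  assumes "x \<in> I e"
  obtains a b where "\<not> int p dvd b" "b \<noteq> 0" "x = of_nat p ^ e * (of_int a / of_int b)"
  using assms by (force simp: I_def)

lemma I_0 [simp, intro]: "0 \<in> I e"
  by (rule II[of 1 _ _ 0]) (use prime_int in auto)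

lemma I_add [intro]:
  assumes "x \<in> I e" "y \<in> I e" shows "x + y \<in> I e"
proof -
  obtain a b where 1: "\<not> int p dvd b" "b \<noteq> 0" "x = of_nat p ^ e * (of_int a / of_int b)"
    using assms(1) by (rule IE)
  obtain c d where 2: "\<not> int p dvd d" "d \<noteq> 0" "y = of_nat p ^ e * (of_int c / of_int d)"
    using assms(2) by (rule IE)
  show ?thesis
  proof (rule II)
    show "\<not> int p dvd b * d"
      using 1 2 prime_int by (simp add: prime_dvd_mult_iff)
    show "x + y = of_nat p ^ e * (of_int (a * d + c * b) / of_int (b * d))"
      using 1 2 by (simp add: divide_simps) (simp add: algebra_simps)
  qed
qed

lemma I_mult:
  assumes "x \<in> I e" "y \<in> I f" shows "x * y \<in> I (e + f)"
proof -
  obtain a b where 1: "\<not> int p dvd b" "b \<noteq> 0" "x = of_nat p ^ e * (of_int a / of_int b)"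
    using assms(1) by (rule IE)
  obtain c d where 2: "\<not> int p dvd d" "d \<noteq> 0" "y = of_nat p ^ f * (of_int c / of_int d)"
    using assms(2) by (rule IE)
  show ?thesis
  proof (rule II)
    show "\<not> int p dvd b * d"
      using 1 2 prime_int by (simp add: prime_dvd_mult_iff)
    show "x * y = of_nat p ^ (e + f) * (of_int (a * c) / of_int (b * d))"
      using 1 2 by (simp add: power_add)
  qed
qed

lemma I_of_int [simp, intro]: "of_int a \<in> I 0"
  by (rule II[of 1 _ _ a]) (use prime_int in auto)

lemma I_of_nat [simp, intro]: "of_nat a \<in> I 0"
  using I_of_int[of "int a"] by simp

lemma I_numeral [simp, intro]: "numeral w \<in> I 0" "1 \<in> I 0"
  using I_of_nat[of "numeral w"] I_of_nat[of 1] by simp_all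

lemma I_mult_0 [intro]: "x \<in> I 0 \<Longrightarrow> y \<in> I e \<Longrightarrow> x * y \<in> I e"
  using I_mult[of x 0 y e] by simp

lemma I_mult_0' [intro]: "x \<in> I e \<Longrightarrow> y \<in> I 0 \<Longrightarrow> x * y \<in> I e"
  using I_mult[of x e y 0] by simp

lemma I_minus [intro]: "x \<in> I e \<Longrightarrow> - x \<in> I e"
  using I_mult_0[OF I_of_int[of "-1"], of x e] by simp

lemma I_diff [intro]: "x \<in> I e \<Longrightarrow> y \<in> I e \<Longrightarrow> x - y \<in> I e"
  using I_add[of x e "- y"] by (simp add: I_minus)

lemma I_sum [intro]: "(\<And>i. i \<in> A \<Longrightarrow> f i \<in> I e) \<Longrightarrow> sum f A \<in> I e"
  by (induction A rule: infinite_finite_induct) auto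

lemma I_prod [intro]: "(\<And>i. i \<in> A \<Longrightarrow> f i \<in> I 0) \<Longrightarrow> prod f A \<in> I 0"
  by (induction A rule: infinite_finite_induct) auto

lemma I_p_power: "of_nat p ^ e \<in> I e"
  by (rule II[of 1 _ _ 1]) (use prime_int in auto)

lemma I_power: "x \<in> I e \<Longrightarrow> x ^ k \<in> I (k * e)"
proof (induction k)
  case (Suc k)
  then show ?case using I_mult[of x e "x ^ k" "k * e"] by simp
qed simp

lemma I_power_0 [intro]: "x \<in> I 0 \<Longrightarrow> x ^ k \<in> I 0"
  using I_power[of x 0 k] by simp

lemma I_antimono:
  assumes "x \<in> I e" "f \<le> e" shows "x \<in> I f"
proof -
  obtain a b where 1: "\<not> int p dvd b" "b \<noteq> 0" "x = of_nat p ^ e * (of_int a / of_int b)"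
    using assms(1) by (rule IE)
  have "x = of_nat p ^ f * (of_int (int p ^ (e - f) * a) / of_int b)"
    using 1(3) assms(2) by (simp flip: power_add mult.assoc)
  with 1(1) show ?thesis by (rule II)
qed

lemma I_of_int_dvd: "int p ^ e dvd a \<Longrightarrow> of_int a \<in> I e"
  by (auto elim!: dvdE intro!: I_mult_0' I_p_power)

lemma I_inverse_int: "\<not> int p dvd b \<Longrightarrow> 1 / of_int b \<in> I 0"
  by (rule II[of b _ _ 1]) auto

lemma I_inverse_nat: "\<not> p dvd b \<Longrightarrow> 1 / of_nat b \<in> I 0"
  using I_inverse_int[of "int b"] by simp

lemma I_divide_int: "x \<in> I e \<Longrightarrow> \<not> int p dvd b \<Longrightarrow> x / of_int b \<in> I e"
  using I_mult_0'[OF _ I_inverse_int, of x e b] by simp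

lemma I_divide_nat: "x \<in> I e \<Longrightarrow> \<not> p dvd b \<Longrightarrow> x / of_nat b \<in> I e"
  using I_divide_int[of x e "int b"] by simp

lemma I_divide_p_power:
  assumes "x \<in> I (e + f)" shows "x / of_nat p ^ f \<in> I e"
proof -
  obtain a b where "\<not> int p dvd b" "x = of_nat p ^ (e + f) * (of_int a / of_int b)"
    using assms by (rule IE)
  then show ?thesis
    by (intro II[of b _ _ a]) (simp_all add: power_add)
qed

lemma not_dvd_less: "0 < j \<Longrightarrow> j < p \<Longrightarrow> \<not> p dvd j"
  by (auto dest: dvd_imp_le)

lemma not_dvd_2: "\<not> p dvd 2"
  using gt_3 by (intro not_dvd_less) auto

lemma not_dvd_mult: "\<not> p dvd a \<Longrightarrow> \<not> p dvd b \<Longrightarrow> \<not> p dvd a * b"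
  using prime by (simp add: prime_dvd_mult_iff)

lemma pcong_refl [simp, intro]: "x \<cong>\<^bsub>e\<^esub> x"
  by (simp add: pcong_def)

lemma pcong_sym: "x \<cong>\<^bsub>e\<^esub> y \<Longrightarrow> y \<cong>\<^bsub>e\<^esub> x"
  unfolding pcong_def using I_minus[of "x - y" e] by simp

lemma pcong_trans [trans]: "x \<cong>\<^bsub>e\<^esub> y \<Longrightarrow> y \<cong>\<^bsub>e\<^esub> z \<Longrightarrow> x \<cong>\<^bsub>e\<^esub> z"
  unfolding pcong_def using I_add[of "x - y" e "y - z"] by simp

text \<open>Without these rules calculations fall back on substitution rules, whose higher-order unification is slow.\<close>

lemma pcong_eq_trans [trans]: "x = y \<Longrightarrow> y \<cong>\<^bsub>e\<^esub> z \<Longrightarrow> x \<cong>\<^bsub>e\<^esub> z" "x \<cong>\<^bsub>e\<^esub> y \<Longrightarrow> y = z \<Longrightarrow> x \<cong>\<^bsub>e\<^esub> z"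
  by simp_all

lemma pcong_antimono: "x \<cong>\<^bsub>e\<^esub> y \<Longrightarrow> f \<le> e \<Longrightarrow> x \<cong>\<^bsub>f\<^esub> y"
  unfolding pcong_def by (rule I_antimono)

lemma pcong_add: "x \<cong>\<^bsub>e\<^esub> y \<Longrightarrow> x' \<cong>\<^bsub>e\<^esub> y' \<Longrightarrow> x + x' \<cong>\<^bsub>e\<^esub> y + y'"
  unfolding pcong_def using I_add[of "x - y" e "x' - y'"] by (simp add: algebra_simps)

lemma pcong_diff: "x \<cong>\<^bsub>e\<^esub> y \<Longrightarrow> x' \<cong>\<^bsub>e\<^esub> y' \<Longrightarrow> x - x' \<cong>\<^bsub>e\<^esub> y - y'"
  unfolding pcong_def using I_diff[of "x - y" e "x' - y'"] by (simp add: algebra_simps)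

lemma pcong_mult_left: "x \<cong>\<^bsub>e\<^esub> y \<Longrightarrow> z \<in> I f \<Longrightarrow> z * x \<cong>\<^bsub>e + f\<^esub> z * y"
  unfolding pcong_def using I_mult[of z f "x - y" e] by (simp add: algebra_simps)

lemma pcong_mult_left0: "x \<cong>\<^bsub>e\<^esub> y \<Longrightarrow> z \<in> I 0 \<Longrightarrow> z * x \<cong>\<^bsub>e\<^esub> z * y"
  using pcong_mult_left[of x e y z 0] by simp

lemma pcong_I: "x \<cong>\<^bsub>e\<^esub> y \<Longrightarrow> x \<in> I e \<longleftrightarrow> y \<in> I e"
  unfolding pcong_def using I_add[of "x - y" e y] I_diff[of x e "x - y"] by auto

lemma pcong_I0: "x \<cong>\<^bsub>e\<^esub> y \<Longrightarrow> x \<in> I 0 \<longleftrightarrow> y \<in> I 0"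
  using pcong_I[of x 0 y] pcong_antimono[of x e y 0] by auto

lemma pcong_mult:
  assumes "x \<cong>\<^bsub>e\<^esub> y" "x' \<cong>\<^bsub>e\<^esub> y'" "x \<in> I 0" "y' \<in> I 0"
  shows "x * x' \<cong>\<^bsub>e\<^esub> y * y'"
proof -
  have "x * x' - y * y' = x * (x' - y') + (x - y) * y'"
    by (simp add: algebra_simps)
  then show ?thesis
    using assms by (auto simp: pcong_def)
qed

lemma pcong_sum: "(\<And>i. i \<in> A \<Longrightarrow> f i \<cong>\<^bsub>e\<^esub> g i) \<Longrightarrow> sum f A \<cong>\<^bsub>e\<^esub> sum g A"
  unfolding pcong_def sum_subtractf[symmetric] by (rule I_sum)

lemma pcong_prod:
  assumes "\<And>i. i \<in> A \<Longrightarrow> f i \<cong>\<^bsub>e\<^esub> g i" "\<And>i. i \<in> A \<Longrightarrow> f i \<in> I 0"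
  shows "prod f A \<cong>\<^bsub>e\<^esub> prod g A"
  using assms
proof (induction A rule: infinite_finite_induct)
  case (insert x F)
  have "g i \<in> I 0" if "i \<in> insert x F" for i
    using insert.prems[OF that] pcong_I0 by blast
  then have "prod g F \<in> I 0" by auto
  moreover have "f x \<cong>\<^bsub>e\<^esub> g x" "prod f F \<cong>\<^bsub>e\<^esub> prod g F" "f x \<in> I 0"
    using insert by auto
  ultimately show ?case
    using insert.hyps by (simp add: pcong_mult)
qed auto

lemma pcong_prod_one:
  "(\<And>i. i \<in> A \<Longrightarrow> f i \<cong>\<^bsub>e\<^esub> 1) \<Longrightarrow> prod f A \<cong>\<^bsub>e\<^esub> 1"
  using pcong_prod[of A f e "\<lambda>_. 1"] pcong_I0[of _ e 1] by auto

text \<open>Every product of two or more of the \<open>f i\<close> lies in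
  \<open>I (2 * e)\<close>.\<close>

lemma pcong_prod_one_minus:
  assumes "\<And>i. i \<in> A \<Longrightarrow> f i \<in> I e"
  shows "(\<Prod>i\<in>A. 1 - f i) \<cong>\<^bsub>2 * e\<^esub> 1 - sum f A"
  using assms
proof (induction A rule: infinite_finite_induct)
  case (insert x F)
  have F: "sum f F \<in> I e" "f x \<in> I e" using insert by auto
  then have "f x * sum f F \<in> I (2 * e)"
    using I_mult[of "f x" e "sum f F" e] by (simp add: mult_2)
  then have 1: "(1 - f x) * (1 - sum f F) \<cong>\<^bsub>2 * e\<^esub> 1 - (f x + sum f F)"
    by (simp add: pcong_def algebra_simps)
  have "1 - f x \<in> I 0"
    using F I_antimono[of "f x" e 0] by auto
  then have "(1 - f x) * (\<Prod>i\<in>F. 1 - f i) \<cong>\<^bsub>2 * e\<^esub> (1 - f x) * (1 - sum f F)"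
    using insert by (intro pcong_mult_left0) auto
  also note 1
  finally show ?case using insert.hyps by simp
qed auto

lemma pcong_cancel_p_power:
  assumes "of_nat p ^ f * x \<cong>\<^bsub>e + f\<^esub> of_nat p ^ f * y"
  shows "x \<cong>\<^bsub>e\<^esub> y"
  using I_divide_p_power[of "of_nat p ^ f * (x - y)" e f] assms
  by (simp add: pcong_def flip: right_diff_distrib)

lemma pcong_cancel_nat:
  assumes "of_nat c * x \<cong>\<^bsub>e\<^esub> of_nat c * y" "\<not> p dvd c"
  shows "x \<cong>\<^bsub>e\<^esub> y"
  using I_divide_nat[of "of_nat c * (x - y)" e c] assms
  by (cases "c = 0") (simp_all add: pcong_def flip: right_diff_distrib)

lemma qcong_iff: "qcong x y p e \<longleftrightarrow> x \<cong>\<^bsub>e\<^esub> y"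
proof -
  define z where "z = (x - y) / of_nat (p ^ e)"
  obtain a b where q: "quotient_of z = (a, b)" by (cases "quotient_of z")
  have b: "b > 0" "z = of_int a / of_int b" "coprime a b"
    using q quotient_of_denom_pos quotient_of_div quotient_of_coprime by blast+
  have xy: "x - y = of_nat p ^ e * z" by (simp add: z_def)
  show ?thesis
  proof
    assume "qcong x y p e"
    then have "\<not> int p dvd b" unfolding qcong_def z_def[symmetric] q by simp
    then show "x \<cong>\<^bsub>e\<^esub> y"
      unfolding pcong_def xy b(2) by (rule II[OF _ refl])
  next
    assume "x \<cong>\<^bsub>e\<^esub> y"
    then obtain c d where cd: "\<not> int p dvd d" "d \<noteq> 0" "x - y = of_nat p ^ e * (of_int c / of_int d)"
      unfolding pcong_def by (rule IE)
    then have "of_int a / of_int b = (of_int c / of_int d :: rat)"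
      unfolding xy b(2) by (simp only: mult_cancel_left power_eq_0_iff of_nat_eq_0_iff p_pos) simp
    then have "(of_int (a * d) :: rat) = of_int (c * b)"
      using cd b(1) by (simp add: field_simps)
    then have "a * d = c * b" by (simp only: of_int_eq_iff)
    \<comment> \<open>\<open>quotient_of\<close> is in lowest terms, so its denominator divides that
      of any other representation.\<close>
    then have "b dvd d"
      using b(3) by (metis coprime_commute coprime_dvd_mult_right_iff dvd_triv_right)
    then have "\<not> int p dvd b" using cd(1) dvd_trans by blast
    then show "qcong x y p e" unfolding qcong_def z_def[symmetric] q by simp
  qed
qed

subsection \<open>Reduction from exponent r + 1 to exponent r\<close>

definition half :: "nat \<Rightarrow> nat" where
  "half r = (p ^ r - 1) div 2"

lemma odd_p: "odd p"
  using prime gt_3 prime_odd_nat[of p] by simp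

lemma half_0 [simp]: "half 0 = 0"
  by (simp add: half_def)

lemma half_eq: "p ^ r = 2 * half r + 1"
proof -
  have "odd (p ^ r)" using odd_p by simp
  then show ?thesis by (auto simp: half_def elim!: oddE)
qed

lemma half_1: "p = 2 * half 1 + 1"
  using half_eq[of 1] by simp

text \<open>All base-p digits of (p^r - 1)/2 equal (p - 1)/2, so dropping the last digit leads from
  exponent r + 1 to r.\<close>

lemma half_Suc: "half (Suc r) = p * half r + half 1"
proof -
  have "2 * half (Suc r) + 1 = p * (2 * half r + 1)"
    using half_eq[of "Suc r"] half_eq[of r] by simp
  also have "\<dots> = 2 * (p * half r) + (2 * half 1 + 1)"
    unfolding half_1[symmetric] by simp
  finally show ?thesis by simp
qed

lemma half_1_less: "half 1 < p"
  using half_1 by simp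

lemma half_Suc_div: "half (Suc r) div p = half r"
  using half_1_less unfolding half_Suc by simp

lemma div_le_half: "k \<le> half (Suc r) \<Longrightarrow> k div p \<le> half r"
  using div_le_mono[of k "half (Suc r)" p] by (simp add: half_Suc_div)

lemma multiples_half: "{k. k \<le> half (Suc r) \<and> p dvd k} = (*) p ` {..half r}"
proof (rule Set.set_eqI, rule iffI)
  fix k assume "k \<in> {k. k \<le> half (Suc r) \<and> p dvd k}"
  then have "k = p * (k div p)" "k div p \<in> {..half r}"
    using div_le_half[of k r] by simp_all
  then show "k \<in> (*) p ` {..half r}" by (rule image_eqI)
next
  fix k assume "k \<in> (*) p ` {..half r}"
  then obtain j where "k = p * j" "j \<le> half r" by auto
  then show "k \<in> {k. k \<le> half (Suc r) \<and> p dvd k}"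
    unfolding half_Suc by (simp add: trans_le_add1)
qed

text \<open>\<open>rho Y k\<close> is the part of the product \<open>phi Y k\<close> that is prime to \<open>p\<close>.\<close>

definition rho :: "rat \<Rightarrow> nat \<Rightarrow> rat" where
  "rho Y k = (\<Prod>j=1..k. (if p dvd 2 * j - 1 then 1 else (of_nat (2 * j - 1))\<^sup>2 - Y)
                        / (if p dvd j then 1 else (of_nat (2 * j))\<^sup>2))"

lemma rho_0 [simp]: "rho Y 0 = 1"
  by (simp add: rho_def)

lemma rho_Suc: "rho Y (Suc k) = rho Y k * ((if p dvd 2 * k + 1 then 1 else (2 * of_nat k + 1)\<^sup>2 - Y)
                        / (if p dvd Suc k then 1 else (2 * of_nat k + 2)\<^sup>2))"
  by (simp add: rho_def algebra_simps)

lemma p_dvd_double: "p dvd 2 * j \<longleftrightarrow> p dvd j"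
  using not_dvd_mult[of 2 j] not_dvd_2 by auto

lemma I_divide_double_square:
  assumes "x \<in> I e" "\<not> p dvd j" shows "x / (of_nat (2 * j))\<^sup>2 \<in> I e"
  using I_divide_nat[OF I_divide_nat[OF assms(1), of "2 * j"], of "2 * j"] assms(2)
  by (simp add: p_dvd_double power2_eq_square)

lemma rho_in_I: "Y \<in> I 0 \<Longrightarrow> rho Y k \<in> I 0"
  unfolding rho_def
proof (rule I_prod)
  fix j assume Y: "Y \<in> I 0"
  have "(of_nat (2 * j - 1))\<^sup>2 - Y \<in> I 0"
    by (intro I_diff I_power_0 I_of_nat Y)
  then show "(if p dvd 2 * j - 1 then 1 else (of_nat (2 * j - 1))\<^sup>2 - Y)
      / (if p dvd j then 1 else (of_nat (2 * j))\<^sup>2) \<in> I 0"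
    by (cases "p dvd j"; cases "p dvd 2 * j - 1")
       (simp_all only: if_True if_False div_by_1 I_numeral I_divide_double_square[OF I_numeral(2)]
          I_divide_double_square[of _ 0] not_False_eq_True)
qed

lemma rho_pcong:
  assumes "Y \<in> I e" shows "rho Y k \<cong>\<^bsub>e\<^esub> rho 0 k"
proof -
  have Y0: "Y \<in> I 0" using assms by (rule I_antimono) simp
  define c where "c = (\<lambda>j. if p dvd j then 1 else (of_nat (2 * j) :: rat)\<^sup>2)"
  have c: "x / c j \<in> I f" if "x \<in> I f" for x j f
    using that I_divide_double_square[of x f j] by (cases "p dvd j") (simp_all only: c_def if_True if_False div_by_1 not_False_eq_True)
  define a where "a = (\<lambda>Y j. (if p dvd 2 * j - 1 then 1 else (of_nat (2 * j - 1))\<^sup>2 - Y :: rat))"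
  have a: "a Y j \<in> I 0" "a Y j - a 0 j \<in> I e" for j
    using Y0 assms by (auto simp: a_def)
  have "(\<Prod>j=1..k. a Y j / c j) \<cong>\<^bsub>e\<^esub> (\<Prod>j=1..k. a 0 j / c j)"
  proof (rule pcong_prod)
    fix j
    show "a Y j / c j \<cong>\<^bsub>e\<^esub> a 0 j / c j"
      unfolding pcong_def diff_divide_distrib[symmetric] by (intro c a)
    show "a Y j / c j \<in> I 0" by (intro c a)
  qed
  then show ?thesis by (simp add: rho_def a_def c_def)
qed

text \<open>Denominators divisible by p occur at j = p i, numerators at 2j - 1 = p (2i - 1). After
  cancelling p^2 each such pair is a factor of \<open>phi X\<close>. If the last digit of k exceeds
  (p-1)/2, there is one numerator more than denominators; the conditional records it.\<close>

lemma phi_factor: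
  "phi ((of_nat p)\<^sup>2 * X) k = phi X (k div p) * rho ((of_nat p)\<^sup>2 * X) k *
     (if k mod p \<le> half 1 then 1 else (of_nat p)\<^sup>2 * ((2 * of_nat (k div p) + 1)\<^sup>2 - X))"
proof (induction k)
  case (Suc k)
  define q i where "q = k div p" and "i = k mod p"
  have k: "k = p * q + i" and i: "i < p" by (simp_all add: q_def i_def)
  have p: "p = 2 * half 1 + 1" by (rule half_1)
  let ?P = "(of_nat p :: rat)\<^sup>2"
  have P0: "?P \<noteq> 0" by simp
  show ?case
  proof (cases "Suc i = p")
    \<comment> \<open>The new denominator is divisible by p and absorbs the surplus
      numerator.\<close>
    case True
    have Sk: "Suc k = p * Suc q" using k True by simp
    have qq: "Suc k div p = Suc q" "Suc k mod p = 0" "p dvd Suc k" unfolding Sk by simp_all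
    have "2 * k + 1 = p * (2 * q + 1) + (p - 1)" using k True by (simp add: algebra_simps)
    moreover have "\<not> p dvd p - 1" by (rule not_dvd_less) (use gt_3 in auto)
    ultimately have nd: "\<not> p dvd 2 * k + 1"
      by (metis dvd_add_right_iff dvd_triv_left)
    have "i > half 1" using True p gt_3 by linarith
    then have ih: "phi (?P * X) k = phi X q * rho (?P * X) k * (?P * ((2 * of_nat q + 1)\<^sup>2 - X))"
      using Suc by (simp flip: q_def i_def)
    have "2 * of_nat k + 2 = (2 * of_nat (Suc k) :: rat)" by simp
    also have "\<dots> = of_nat p * (2 * of_nat q + 2)" unfolding Sk by (simp add: algebra_simps)
    finally have k2: "(2 * of_nat k + 2 :: rat)\<^sup>2 = ?P * (2 * of_nat q + 2)\<^sup>2"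
      by (simp add: power_mult_distrib)
    show ?thesis
      unfolding phi_Suc[of _ k] ih rho_Suc qq k2 phi_Suc[of _ q] using nd qq(3) P0 by simp
  next
    case False
    then have Sk: "Suc k = p * q + Suc i" "Suc i < p" using k i by auto
    have qq: "Suc k div p = q" "Suc k mod p = Suc i" "\<not> p dvd Suc k"
    proof -
      have "(Suc i + p * q) div p = q + Suc i div p"
        by (rule div_mult_self2) simp
      then show "Suc k div p = q" using Sk by (simp add: add.commute)
      have "(Suc i + p * q) mod p = Suc i mod p"
        by (rule mod_mult_self2)
      then show "Suc k mod p = Suc i" using Sk by (simp add: add.commute)
      then show "\<not> p dvd Suc k" by (simp add: dvd_eq_mod_eq_0)
    qed
    have dvd: "p dvd 2 * k + 1 \<longleftrightarrow> i = half 1"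
    proof
      assume "i = half 1"
      then have "2 * k + 1 = p * (2 * q) + p" using k p by linarith
      then show "p dvd 2 * k + 1" by simp
    next
      assume "p dvd 2 * k + 1"
      moreover have "2 * k + 1 = p * (2 * q) + (2 * i + 1)" using k by simp
      ultimately have "p dvd 2 * i + 1" by (metis dvd_add_right_iff dvd_triv_left)
      then obtain c where c: "2 * i + 1 = p * c" by auto
      with i have "p * c < p * 2" by linarith
      then have "c < 2" by simp
      moreover have "c \<noteq> 0" using c by (metis add_is_0 mult_0_right one_neq_zero)
      ultimately have "c = 1" by simp
      with c have "2 * i + 1 = p" by simp
      with p show "i = half 1" by linarith
    qed
    show ?thesis
    proof (cases "i = half 1")
      \<comment> \<open>The new numerator is divisible by p; it creates the surplus factor.\<close>
      case True
      then have "2 * k + 1 = p * (2 * q) + p" using k p by linarith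
      then have "2 * k + 1 = p * (2 * q + 1)" by simp
      then have "of_nat (2 * k + 1) = (of_nat (p * (2 * q + 1)) :: rat)"
        by (rule arg_cong)
      then have "2 * of_nat k + 1 = (of_nat p * (2 * of_nat q + 1) :: rat)"
        by (simp only: of_nat_add of_nat_mult of_nat_numeral of_nat_1)
      then have "(2 * of_nat k + 1)\<^sup>2 - ?P * X = ?P * ((2 * of_nat q + 1)\<^sup>2 - X)"
        by (simp add: power_mult_distrib right_diff_distrib)
      then show ?thesis
        using Suc dvd qq True unfolding phi_Suc[of _ k] rho_Suc qq by (simp flip: q_def i_def)
    next
      case False
      then have "i \<le> half 1 \<longleftrightarrow> Suc i \<le> half 1" by auto
      then show ?thesis
        using Suc dvd qq False unfolding phi_Suc[of _ k] rho_Suc qq by (simp flip: q_def i_def)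
    qed
  qed
qed simp

text \<open>Modulo an odd \<open>q\<close> the odd number \<open>2 * j - 1\<close> is the even number \<open>2 * (j + (q - 1) div 2)\<close>, so both
  products run over the same residues with a cyclic shift.\<close>

lemma pcong_odd_even_product:
  assumes "p dvd K" "p ^ v dvd K"
  defines "f \<equiv> \<lambda>a. if p dvd a then 1 else a :: nat"
  shows "[(\<Prod>j=1..K. f (2 * j - 1)) = (\<Prod>j=1..K. f (2 * j))] (mod p ^ v)"
proof (cases "v = 0")
  case False
  define q where "q = p ^ v"
  define t where "t = half v"
  have q: "q = 2 * t + 1" "p dvd q" "q dvd K"
    using half_eq[of v] False assms(2) dvd_power[of v p] unfolding q_def t_def by blast+
  have per: "[f (a + b) = f a] (mod q)" if "q dvd b" for a b
  proof -
    have "p dvd b" using q(2) that by (rule dvd_trans)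
    then have "p dvd a + b \<longleftrightarrow> p dvd a" by (simp add: dvd_add_left_iff)
    moreover have "[a + b = a] (mod q)" using that by (simp add: cong_def mod_add_eq[symmetric] flip: mod_add_right_eq)
    ultimately show ?thesis by (simp add: f_def)
  qed
  define F where "F = (\<lambda>j. f (2 * j))"
  have copr: "coprime (\<Prod>j\<in>A. F j) q" for A
  proof (rule prod_coprime_left)
    fix j
    show "coprime (F j) q"
      using prime by (auto simp: F_def f_def q_def coprime_commute prime_imp_coprime simp del: coprime_mult_right_iff)
  qed
  have shift: "(\<Prod>j=1..a. F j) * (\<Prod>j=1..b. F (j + a)) = (\<Prod>j=1..a + b. F j)" for a b
    by (induction b) (simp_all add: add.commute flip: mult.assoc)
  have "[(\<Prod>j=1..K. f (2 * j - 1)) = (\<Prod>j=1..K. F (j + t))] (mod q)"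
  proof (rule cong_prod)
    fix j assume "j \<in> {1..K}"
    then have "2 * (j + t) = (2 * j - 1) + q" using q(1) by auto
    then show "[f (2 * j - 1) = F (j + t)] (mod q)"
      using per[of q "2 * j - 1"] by (simp add: F_def cong_sym del: distrib_left_numeral)
  qed
  also have "[(\<Prod>j=1..K. F (j + t)) = (\<Prod>j=1..K. F j)] (mod q)"
  proof -
    have "[(\<Prod>j=1..t. F (j + K)) = (\<Prod>j=1..t. F j)] (mod q)"
    proof (rule cong_prod)
      fix j
      have "2 * (j + K) = 2 * j + 2 * K" "q dvd 2 * K" using q(3) by simp_all
      then show "[F (j + K) = F j] (mod q)" unfolding F_def using per[of "2 * K" "2 * j"] by argo
    qed
    then have "[(\<Prod>j=1..K. F j) * (\<Prod>j=1..t. F (j + K)) = (\<Prod>j=1..K. F j) * (\<Prod>j=1..t. F j)] (mod q)"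
      by (rule cong_scalar_left)
    \<comment> \<open>Both sides are the product over 1..K+t, split at t and at K; the t common
      factors are prime to p and cancel.\<close>
    then have "[(\<Prod>j=1..K. F (j + t)) * (\<Prod>j=1..t. F j) = (\<Prod>j=1..K. F j) * (\<Prod>j=1..t. F j)] (mod q)"
      unfolding shift[of K t] add.commute[of K t] by (simp only: shift[of t K, symmetric] mult.commute)
    then show ?thesis
      using cong_mult_rcancel_nat[OF copr] by blast
  qed
  finally show ?thesis unfolding F_def q_def .
qed (simp add: cong_def)

text \<open>At Y = 0, \<open>rho\<close> is the quotient of the squares of the two products just
  compared, both prime to p.\<close>

lemma rho_multiple_pcong:
  assumes "p dvd K" "p ^ v dvd K"
  shows "rho 0 K \<cong>\<^bsub>v\<^esub> 1"
proof -
  define f where "f = (\<lambda>a. if p dvd a then 1 else a :: nat)"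
  define A B where "A = (\<Prod>j=1..K. f (2 * j - 1))" and "B = (\<Prod>j=1..K. f (2 * j))"
  have nd: "\<not> p dvd f a" for a
    using prime by (auto simp: f_def)
  then have B: "\<not> p dvd B"
    unfolding B_def using prime by (simp add: prime_dvd_prod_iff)
  then have "B \<noteq> 0" by (metis dvd_0_right)
  have "rho 0 K = (\<Prod>j=1..K. (of_nat (f (2 * j - 1)))\<^sup>2 / (of_nat (f (2 * j)))\<^sup>2)"
    unfolding rho_def by (intro prod.cong refl) (auto simp: f_def p_dvd_double)
  also have "\<dots> = (of_nat A)\<^sup>2 / (of_nat B)\<^sup>2"
    by (simp add: A_def B_def prod_dividef prod_power_distrib)
  finally have "rho 0 K - 1 = (of_nat A - of_nat B) * (of_nat A + of_nat B) / of_nat B / of_nat B"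
    using \<open>B \<noteq> 0\<close> by (simp add: field_simps power2_eq_square)
  moreover have "of_nat A - of_nat B \<in> I v"
  proof -
    have "[A = B] (mod p ^ v)"
      unfolding A_def B_def f_def by (rule pcong_odd_even_product) fact+
    then have "int p ^ v dvd int A - int B"
      by (metis cong_iff_dvd_diff cong_int_iff of_nat_power)
    then have "of_int (int A - int B) \<in> I v" by (rule I_of_int_dvd)
    then show ?thesis by simp
  qed
  then have "(of_nat A - of_nat B) * (of_nat A + of_nat B) / of_nat B / of_nat B \<in> I v"
    by (intro I_divide_nat I_mult_0' I_add I_of_nat B)
  ultimately show ?thesis unfolding pcong_def by argo
qed

section \<open>Product and error term for exponent r: valuations and comparison\<close>

definition weight :: "nat \<Rightarrow> nat \<Rightarrow> rat" where
  "weight r k = of_nat (p ^ r) / (of_nat (p ^ r) - 2 * of_nat k)"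

definition phi_diff :: "nat \<Rightarrow> nat \<Rightarrow> rat" where
  "phi_diff r k = phi 0 k - phi ((of_nat (p ^ r))\<^sup>2) k"

definition error_term :: "nat \<Rightarrow> rat" where
  "error_term r = (\<Sum>k\<le>half r. weight r k * phi_diff r k)"

definition main_term :: "nat \<Rightarrow> rat" where
  "main_term r = (\<Prod>j=1..half r. 1 - (of_nat (p ^ r) / (2 * of_nat j))\<^sup>2)"

text \<open>Each use of \<open>phi_factor\<close> strips p^2 from the argument and the last base-p
  digit from k; the bound on k ensures that k is used up after r rounds.\<close>

lemma phi_in_I:
  assumes "Y \<in> I 0" "k \<le> half r"
  shows "phi ((of_nat p) ^ (2 * r) * Y) k \<in> I 0"
  using assms(2)
proof (induction r arbitrary: k)
  case (Suc r)
  define X where "X = of_nat p ^ (2 * r) * Y"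
  have X: "X \<in> I 0"
    unfolding X_def by (intro I_mult_0 I_power_0 I_of_nat assms)
  have eq: "of_nat p ^ (2 * Suc r) * Y = (of_nat p)\<^sup>2 * X"
    by (simp add: X_def power2_eq_square)
  have P: "(of_nat p)\<^sup>2 \<in> I 0"
    by (intro I_power_0 I_of_nat)
  have "(2 * of_nat (k div p) + 1)\<^sup>2 - X \<in> I 0"
    by (intro I_diff I_power_0 I_add I_mult_0 I_of_nat I_numeral X)
  then have "(if k mod p \<le> half 1 then 1 else (of_nat p)\<^sup>2 * ((2 * of_nat (k div p) + 1)\<^sup>2 - X)) \<in> I 0"
    using P I_mult_0 by simp
  moreover have "phi X (k div p) \<in> I 0"
    unfolding X_def using Suc by (intro Suc.IH div_le_half)
  moreover have "rho ((of_nat p)\<^sup>2 * X) k \<in> I 0"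
    by (intro rho_in_I I_mult_0 P X)
  ultimately show ?case
    unfolding eq phi_factor by (intro I_mult_0)
qed simp

lemma phi_0_in_I: "k \<le> half r \<Longrightarrow> phi 0 k \<in> I 0"
  using phi_in_I[of 0 k r] by simp

lemma phi_diff_factor:
  "phi_diff (Suc r) k = (phi 0 (k div p) * rho 0 k - phi ((of_nat (p ^ r))\<^sup>2) (k div p) * rho ((of_nat (p ^ Suc r))\<^sup>2) k)"
  if "k mod p \<le> half 1"
proof -
  have "(of_nat (p ^ Suc r))\<^sup>2 = (of_nat p)\<^sup>2 * (of_nat (p ^ r) :: rat)\<^sup>2"
    by (simp add: power_mult_distrib)
  then show ?thesis
    using that phi_factor[of 0 k] phi_factor[of "(of_nat (p ^ r))\<^sup>2" k] by (simp add: phi_diff_def)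
qed

lemma rho_p_power: "rho ((of_nat (p ^ r))\<^sup>2) k \<cong>\<^bsub>2 * r\<^esub> rho 0 k"
  using I_power[OF I_p_power[of r], of 2] by (intro rho_pcong) simp

lemma phi_p_power_in_I: "k \<le> half r \<Longrightarrow> phi ((of_nat (p ^ r))\<^sup>2) k \<in> I 0"
  using phi_in_I[of 1 k r] by (simp add: power_mult mult.commute flip: power_mult)

text \<open>For such k there is no surplus numerator, and the two \<open>rho\<close> factors of the
  difference agree modulo p^(2(r+1)).\<close>

lemma phi_diff_pcong:
  assumes "k \<le> half (Suc r)" "k mod p \<le> half 1"
  shows "phi_diff (Suc r) k \<cong>\<^bsub>2 * Suc r\<^esub> phi_diff r (k div p) * rho 0 k"
proof -
  let ?L = "phi ((of_nat (p ^ r))\<^sup>2) (k div p)"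
  have "phi_diff (Suc r) k - phi_diff r (k div p) * rho 0 k = ?L * (rho 0 k - rho ((of_nat (p ^ Suc r))\<^sup>2) k)"
    unfolding phi_diff_factor[OF assms(2)] by (simp add: phi_diff_def algebra_simps)
  moreover have "?L \<in> I 0"
    using assms(1) by (intro phi_p_power_in_I div_le_half)
  moreover have "rho 0 k - rho ((of_nat (p ^ Suc r))\<^sup>2) k \<in> I (2 * Suc r)"
    using pcong_sym[OF rho_p_power[of "Suc r" k]] by (simp only: pcong_def)
  ultimately show ?thesis unfolding pcong_def by (metis I_mult_0)
qed

text \<open>Induction over the base-p digits of k: a last digit up to (p-1)/2 hands the claim on to
  \<open>k div p\<close>, a larger one gives both terms of the difference a surplus factor
  p^2.\<close>

lemma phi_diff_in_I: "k \<le> half r \<Longrightarrow> phi_diff r k \<in> I 2"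
proof (induction r arbitrary: k)
  case (Suc r)
  note k = div_le_half[OF Suc.prems]
  have P: "(of_nat p)\<^sup>2 \<in> I 2"
    by (rule I_p_power)
  show ?case
  proof (cases "k mod p \<le> half 1")
    case True
    have "phi_diff (Suc r) k \<cong>\<^bsub>2\<^esub> phi_diff r (k div p) * rho 0 k"
      by (rule pcong_antimono[OF phi_diff_pcong[OF Suc.prems True]]) simp
    moreover have "phi_diff r (k div p) * rho 0 k \<in> I 2"
      by (intro I_mult_0' Suc.IH k rho_in_I I_0)
    ultimately show ?thesis using pcong_I by blast
  next
    case False
    have *: "phi ((of_nat p)\<^sup>2 * X) k \<in> I 2" if "X \<in> I 0" "phi X (k div p) \<in> I 0" for X
    proof -
      have "phi ((of_nat p)\<^sup>2 * X) k = (of_nat p)\<^sup>2 * (phi X (k div p) * rho ((of_nat p)\<^sup>2 * X) k * ((2 * of_nat (k div p) + 1)\<^sup>2 - X))"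
        unfolding phi_factor using False by simp
      also have "\<dots> \<in> I 2"
        using that I_antimono[OF P, of 0]
        by (intro I_mult_0'[OF P] I_mult_0 rho_in_I I_diff I_power_0 I_add I_of_nat I_numeral) auto
      finally show ?thesis .
    qed
    have X: "(of_nat (p ^ r))\<^sup>2 \<in> I 0" by (intro I_power_0 I_of_nat)
    have eq: "(of_nat (p ^ Suc r))\<^sup>2 = (of_nat p)\<^sup>2 * (of_nat (p ^ r) :: rat)\<^sup>2"
      by (simp add: power_mult_distrib)
    show ?thesis
      unfolding phi_diff_def eq
      using *[OF I_0 phi_0_in_I[OF k]] *[OF X phi_p_power_in_I[OF k]] by auto
  qed
qed (simp add: phi_diff_def)

lemma small_multiplicity:
  assumes "0 < k" "k \<le> half r"
  obtains t k' where "t < r" "k = p ^ t * k'" "\<not> p dvd k'"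
proof -
  obtain k' where k': "k = p ^ multiplicity p k * k'" "\<not> p dvd k'"
    using multiplicity_decompose'[of k p] assms(1) gt_3 by auto
  have "p ^ multiplicity p k \<le> k"
    using assms(1) multiplicity_dvd[of p k] by (rule dvd_imp_le[rotated])
  also have "k < p ^ r"
    using assms half_eq[of r] by simp
  finally have "multiplicity p k < r"
    using gt_3 by simp
  with k' show thesis using that by blast
qed

text \<open>Here t is the p-adic valuation of k. As t < r and p is odd, p^r - 2k has the same
  valuation.\<close>

lemma weight_valuation:
  assumes "0 < k" "k \<le> half r"
  obtains t where "t < r" "p ^ t dvd k" "weight r k \<in> I (r - t)" "of_nat (p ^ r) / of_nat k \<in> I (r - t)"
proof -
  obtain t k' where t: "t < r" "k = p ^ t * k'" "\<not> p dvd k'"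
    using assms by (rule small_multiplicity)
  define c where "c = int (p ^ (r - t)) - 2 * int k'"
  have c: "\<not> int p dvd c"
  proof
    assume "int p dvd c"
    moreover have "int p dvd int (p ^ (r - t))"
      using t(1) by simp
    ultimately have "int p dvd 2 * int k'"
      unfolding c_def using dvd_diff_right_iff by blast
    then have "int p dvd int (2 * k')" by simp
    then have "p dvd 2 * k'" by (simp only: int_dvd_int_iff)
    then show False using t(3) p_dvd_double by simp
  qed
  then have "c \<noteq> 0" by auto
  have n: "of_nat (p ^ r) = (of_nat p ^ t * of_nat p ^ (r - t) :: rat)"
    using t(1) by (simp flip: power_add)
  have "of_nat (p ^ r) - 2 * of_nat k = of_nat p ^ t * (of_int c :: rat)"
    unfolding n t(2) by (simp add: c_def algebra_simps)
  then have "weight r k = of_nat p ^ (r - t) / of_int c"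
    unfolding weight_def n by simp
  moreover have "of_nat (p ^ r) / of_nat k = (of_nat p ^ (r - t) / of_nat k' :: rat)"
    unfolding n t(2) by simp
  ultimately show thesis
    using that[of t] t c I_divide_int[OF I_p_power c] I_divide_nat[OF I_p_power t(3)] by simp
qed

lemma weight_in_I: "k \<le> half r \<Longrightarrow> weight r k \<in> I 0"
proof (cases "k = 0")
  case True
  then show ?thesis by (simp add: weight_def)
next
  case False
  assume "k \<le> half r"
  then obtain t where "weight r k \<in> I (r - t)"
    using False weight_valuation by blast
  then show ?thesis by (rule I_antimono) simp
qed

lemma weight_in_I_coprime:
  assumes "k \<le> half r" "\<not> p dvd k"
  shows "weight r k \<in> I r"
proof -
  have "k > 0" using assms(2) by (cases k) auto
  then obtain t where t: "p ^ t dvd k" "weight r k \<in> I (r - t)"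
    using assms(1) weight_valuation by blast
  have "t = 0"
  proof (rule ccontr)
    assume "t \<noteq> 0"
    then have "p dvd p ^ t" by simp
    with t(1) assms(2) show False using dvd_trans by blast
  qed
  with t show ?thesis by simp
qed

lemma weight_multiple: "weight (Suc r) (p * k) = weight r k"
proof -
  have "of_nat (p ^ Suc r) - 2 * of_nat (p * k) = (of_nat p * (of_nat (p ^ r) - 2 * of_nat k) :: rat)"
    by (simp add: algebra_simps)
  then show ?thesis by (simp add: weight_def)
qed

text \<open>A valuation t of k costs the weight t powers of p, but brings
  \<open>rho 0 (p * k)\<close> to 1 modulo p^(t+1); the two effects balance.\<close>

lemma weight_rho_pcong:
  assumes "k \<le> half r" "r \<ge> 1"
  shows "weight r k * rho 0 (p * k) \<cong>\<^bsub>r + 1\<^esub> weight r k"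
proof (cases "k = 0")
  case False
  then obtain t where t: "t < r" "p ^ t dvd k" "weight r k \<in> I (r - t)"
    using assms(1) weight_valuation by blast
  have "rho 0 (p * k) \<cong>\<^bsub>t + 1\<^esub> 1"
    by (rule rho_multiple_pcong) (use t in auto)
  then have "weight r k * rho 0 (p * k) \<cong>\<^bsub>(t + 1) + (r - t)\<^esub> weight r k * 1"
    using t(3) by (rule pcong_mult_left)
  then show ?thesis using t(1) by simp
qed simp

lemma sum_split_multiples:
  "(\<Sum>k\<le>half (Suc r). f k) = (\<Sum>k\<le>half r. f (p * k)) + (\<Sum>k | k \<le> half (Suc r) \<and> \<not> p dvd k. f k)"
proof -
  have "(\<Sum>k\<le>half (Suc r). f k) = sum f {k. k \<le> half (Suc r) \<and> p dvd k} + sum f {k. k \<le> half (Suc r) \<and> \<not> p dvd k}"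
    by (subst sum.union_disjoint[symmetric]) (auto intro: sum.cong)
  also have "sum f {k. k \<le> half (Suc r) \<and> p dvd k} = (\<Sum>k\<le>half r. f (p * k))"
    unfolding multiples_half by (subst sum.reindex) (auto intro: inj_onI)
  finally show ?thesis .
qed

lemma prod_split_multiples:
  "(\<Prod>k=1..half (Suc r). f k) = (\<Prod>k=1..half r. f (p * k)) * (\<Prod>k | k \<le> half (Suc r) \<and> \<not> p dvd k. f k)"
proof -
  have "{1..half (Suc r)} = ({k. k \<le> half (Suc r) \<and> p dvd k} - {0}) \<union> {k. k \<le> half (Suc r) \<and> \<not> p dvd k}"
    by (auto simp: Suc_le_eq intro: gr0I)
  then have "(\<Prod>k=1..half (Suc r). f k) = prod f ({k. k \<le> half (Suc r) \<and> p dvd k} - {0})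
      * prod f {k. k \<le> half (Suc r) \<and> \<not> p dvd k}"
    by (simp only:) (subst prod.union_disjoint; auto)
  also have "{k. k \<le> half (Suc r) \<and> p dvd k} - {0} = (*) p ` {1..half r}"
    unfolding multiples_half by (auto simp: image_iff Suc_le_eq)
  also have "prod f \<dots> = (\<Prod>k=1..half r. f (p * k))"
    by (subst prod.reindex) (auto intro: inj_onI)
  finally show ?thesis .
qed

text \<open>All discarded quantities are divisible by p^(2r+2) or by p^(r+3), the latter as p^(r+1)
  from the weight times p^2 from \<open>phi_diff\<close>. Both suffice from r = 1 on.\<close>

lemma error_term_Suc:
  assumes "r \<ge> 1" shows "error_term (Suc r) \<cong>\<^bsub>4\<^esub> error_term r"
proof -
  have "(\<Sum>k\<le>half r. weight (Suc r) (p * k) * phi_diff (Suc r) (p * k)) \<cong>\<^bsub>4\<^esub> error_term r"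
    unfolding error_term_def
  proof (rule pcong_sum)
    fix k assume "k \<in> {..half r}"
    then have k: "k \<le> half r" by simp
    have pk: "p * k \<le> half (Suc r)" using k unfolding half_Suc by (simp add: trans_le_add1)
    have "phi_diff (Suc r) (p * k) \<cong>\<^bsub>2 * Suc r\<^esub> phi_diff r k * rho 0 (p * k)"
      using phi_diff_pcong[OF pk] by simp
    then have "phi_diff (Suc r) (p * k) \<cong>\<^bsub>4\<^esub> phi_diff r k * rho 0 (p * k)"
      by (rule pcong_antimono) (use assms in simp)
    then have "weight r k * phi_diff (Suc r) (p * k) \<cong>\<^bsub>4\<^esub> weight r k * (phi_diff r k * rho 0 (p * k))"
      using weight_in_I[OF k] by (rule pcong_mult_left0)
    also have "\<dots> = phi_diff r k * (weight r k * rho 0 (p * k))" by simp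
    also have "\<dots> \<cong>\<^bsub>4\<^esub> phi_diff r k * weight r k"
    proof -
      have "phi_diff r k * (weight r k * rho 0 (p * k)) \<cong>\<^bsub>(r + 1) + 2\<^esub> phi_diff r k * weight r k"
        by (rule pcong_mult_left[OF weight_rho_pcong[OF k assms] phi_diff_in_I[OF k]])
      then show ?thesis by (rule pcong_antimono) (use assms in simp)
    qed
    finally show "weight (Suc r) (p * k) * phi_diff (Suc r) (p * k) \<cong>\<^bsub>4\<^esub> weight r k * phi_diff r k"
      unfolding weight_multiple mult.commute[of "phi_diff r k" "weight r k"] .
  qed
  moreover have "(\<Sum>k | k \<le> half (Suc r) \<and> \<not> p dvd k. weight (Suc r) k * phi_diff (Suc r) k) \<in> I 4"
  proof (rule I_sum)
    fix k assume k: "k \<in> {k. k \<le> half (Suc r) \<and> \<not> p dvd k}"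
    then have "weight (Suc r) k * phi_diff (Suc r) k \<in> I (Suc r + 2)"
      by (intro I_mult weight_in_I_coprime phi_diff_in_I) auto
    then show "weight (Suc r) k * phi_diff (Suc r) k \<in> I 4"
      by (rule I_antimono) (use assms in simp)
  qed
  ultimately have "error_term (Suc r) \<cong>\<^bsub>4\<^esub> error_term r + 0"
    unfolding error_term_def[of "Suc r"] sum_split_multiples
    by (intro pcong_add) (simp_all add: pcong_def)
  then show ?thesis by simp
qed

lemma main_term_Suc:
  assumes "r \<ge> 1" shows "main_term (Suc r) \<cong>\<^bsub>4\<^esub> main_term r"
proof -
  let ?f = "\<lambda>r j. 1 - (of_nat (p ^ r) / (2 * of_nat j))\<^sup>2 :: rat"
  have m: "main_term (Suc r) = main_term r * (\<Prod>k | k \<le> half (Suc r) \<and> \<not> p dvd k. ?f (Suc r) k)"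
    unfolding main_term_def prod_split_multiples by simp
  have "(\<Prod>k | k \<le> half (Suc r) \<and> \<not> p dvd k. ?f (Suc r) k) \<cong>\<^bsub>4\<^esub> 1"
  proof (rule pcong_prod_one)
    fix k assume "k \<in> {k. k \<le> half (Suc r) \<and> \<not> p dvd k}"
    then have "\<not> p dvd 2 * k" using p_dvd_double by simp
    from I_divide_nat[OF I_p_power this, of "Suc r"]
    have "(of_nat (p ^ Suc r) / (2 * of_nat k))\<^sup>2 \<in> I (2 * Suc r)"
      by (intro I_power) simp
    then have "(of_nat (p ^ Suc r) / (2 * of_nat k))\<^sup>2 \<in> I 4"
      by (rule I_antimono) (use assms in simp)
    then show "?f (Suc r) k \<cong>\<^bsub>4\<^esub> 1"
      using I_minus by (simp add: pcong_def)
  qed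
  moreover have "main_term r \<in> I 0"
    unfolding main_term_def
  proof (rule I_prod)
    fix j assume "j \<in> {1..half r}"
    then obtain t where "of_nat (p ^ r) / of_nat j \<in> I (r - t)"
      using weight_valuation[of j r] by auto
    then have "of_nat (p ^ r) / of_nat j / of_nat 2 \<in> I (r - t)"
      using not_dvd_2 by (rule I_divide_nat)
    then have "of_nat (p ^ r) / (2 * of_nat j) \<in> I 0"
      by (intro I_antimono[of _ "r - t" 0]) (simp_all add: mult.commute)
    then show "?f r j \<in> I 0"
      by (intro I_diff I_power_0 I_numeral)
  qed
  ultimately show ?thesis
    unfolding m using pcong_mult_left0[of _ 4 1 "main_term r"] by simp
qed

text \<open>Allows u_m to be dropped in front of the error term, which is itself divisible by
  p^3.\<close>

lemma phi_0_half: "phi 0 (half r) \<cong>\<^bsub>1\<^esub> 1"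
  unfolding phi_0_reflect[OF half_eq]
proof (rule pcong_prod_one)
  fix j assume "j \<in> {1..half r}"
  then obtain t where t: "t < r" "of_nat (p ^ r) / of_nat j \<in> I (r - t)"
    using weight_valuation[of j r] by auto
  define x :: rat where "x = of_nat (p ^ r) / (2 * of_nat j)"
  have "of_nat (p ^ r) / of_nat j / of_nat 2 \<in> I (r - t)"
    using t(2) not_dvd_2 by (rule I_divide_nat)
  then have x: "x \<in> I 1"
    using t(1) by (intro I_antimono[of _ "r - t" 1]) (simp_all add: x_def mult.commute)
  then have "x * (x - 2) \<in> I 1"
    by (intro I_mult_0' I_diff I_numeral I_antimono[OF x]) auto
  moreover have "(1 - x)\<^sup>2 - 1 = x * (x - 2)"
    by (simp add: power2_eq_square algebra_simps)
  ultimately show "(1 - of_nat (p ^ r) / (2 * of_nat j))\<^sup>2 \<cong>\<^bsub>1\<^esub> 1"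
    by (simp add: pcong_def x_def)
qed

lemma sum_pcong_level_1:
  assumes "r \<ge> 1" "error_term 1 \<in> I 3"
  shows "(\<Sum>k\<le>half r. of_nat (4 * k + 1) * (phi 0 k)\<^sup>2) \<cong>\<^bsub>r + 4\<^esub> of_nat (p ^ r) * (main_term 1 + error_term 1)"
proof -
  have me: "main_term r \<cong>\<^bsub>4\<^esub> main_term 1 \<and> error_term r \<cong>\<^bsub>4\<^esub> error_term 1"
    using assms(1)
  proof (induction r rule: dec_induct)
    case (step n)
    then show ?case using main_term_Suc[of n] error_term_Suc[of n] pcong_trans by blast
  qed simp
  have "phi 0 (half r) * error_term r \<cong>\<^bsub>4\<^esub> phi 0 (half r) * error_term 1"
    using me phi_0_in_I[of "half r" r] by (intro pcong_mult_left0) auto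
  also have "\<dots> = error_term 1 * phi 0 (half r)" by simp
  also have "\<dots> \<cong>\<^bsub>4\<^esub> error_term 1 * 1"
    using pcong_mult_left[OF phi_0_half assms(2), of r] by simp
  finally have "main_term r + phi 0 (half r) * error_term r \<cong>\<^bsub>4\<^esub> main_term 1 + error_term 1"
    using me by (intro pcong_add) auto
  then have "of_nat (p ^ r) * (main_term r + phi 0 (half r) * error_term r) \<cong>\<^bsub>4 + r\<^esub> of_nat (p ^ r) * (main_term 1 + error_term 1)"
    using I_p_power[of r] by (intro pcong_mult_left) simp_all
  then show ?thesis
    unfolding sum_decomposition[OF half_eq[of r]] main_term_def error_term_def weight_def phi_diff_def
    by (simp add: add.commute)
qed

subsection \<open>Power sums and harmonic sums modulo p\<close>

definition h :: nat where "h = half 1"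

lemma p_eq: "p = 2 * h + 1"
  unfolding h_def by (rule half_1)

lemma p_minus_1: "p - 1 = h + h"
  using p_eq by linarith

lemma h_less: "h < p" "2 * h < p" "h \<ge> 2"
  using p_eq gt_3 by linarith+

text \<open>Up to this index the recurrence divides only by numbers n + 1 < p.\<close>

lemma bernoulli_in_I: "n \<le> p - 2 \<Longrightarrow> bernoulli n \<in> I 0"
proof (induction n rule: less_induct)
  case (less n)
  have "n + 1 < p" using less.prems gt_3 by linarith
  then have nd: "\<not> p dvd n + 1" by (intro not_dvd_less) auto
  show ?case
  proof (cases "n = 0")
    case False
    have "(\<Sum>j<n. of_nat ((n + 1) choose j) * bernoulli j) \<in> I 0"
      using less by (intro I_sum I_mult_0 I_of_nat) auto
    then have "- (\<Sum>j<n. of_nat ((n + 1) choose j) * bernoulli j) / of_nat (n + 1) \<in> I 0"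
      using nd by (intro I_divide_nat I_minus)
    then show ?thesis using False bernoulli.simps[of n] by simp
  qed (simp add: bernoulli.simps[of 0])
qed

lemma sum_power_lessThan: "s > 0 \<Longrightarrow> (\<Sum>t<p. of_nat t ^ s :: rat) = (\<Sum>t=1..p-1. of_nat t ^ s)"
proof -
  assume "s > 0"
  have "{..<p} = insert 0 {1..p-1}" using gt_3 by auto
  with \<open>s > 0\<close> show ?thesis by simp
qed

lemma p_power_in_I: "e \<le> f \<Longrightarrow> of_nat p ^ f \<in> I e"
  by (rule I_antimono[OF I_p_power])

text \<open>In Faulhaber's formula at N = p the i-th term carries p^(s+1-i), so only i = s survives
  modulo p^2; the factor s + 1 is prime to p.\<close>

lemma power_sum_pcong:
  assumes "0 < s" "s \<le> p - 2"
  shows "(\<Sum>t=1..p-1. of_nat t ^ s) \<cong>\<^bsub>2\<^esub> of_nat p * bernoulli s"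
proof -
  let ?f = "\<lambda>i. of_nat ((s + 1) choose i) * bernoulli i * of_nat p ^ (s + 1 - i) :: rat"
  have "of_nat (s + 1) * (\<Sum>t<p. of_nat t ^ s) = sum ?f {..s}"
    by (rule faulhaber)
  also have "sum ?f {..s} = ?f s + sum ?f {..<s}"
    by (simp flip: lessThan_Suc_atMost)
  also have "\<dots> \<cong>\<^bsub>2\<^esub> ?f s + 0"
  proof (rule pcong_add)
    have "sum ?f {..<s} \<in> I 2"
    proof (rule I_sum)
      fix i assume i: "i \<in> {..<s}"
      then have "bernoulli i \<in> I 0" using assms by (intro bernoulli_in_I) auto
      moreover have "of_nat p ^ (s + 1 - i) \<in> I 2" using i by (intro p_power_in_I) auto
      ultimately show "?f i \<in> I 2" by (intro I_mult_0 I_of_nat)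
    qed
    then show "sum ?f {..<s} \<cong>\<^bsub>2\<^esub> 0" by (simp add: pcong_def)
  qed simp
  also have "?f s + 0 = of_nat (s + 1) * (of_nat p * bernoulli s)"
    by simp
  finally have "(\<Sum>t<p. of_nat t ^ s) \<cong>\<^bsub>2\<^esub> of_nat p * bernoulli s"
    using assms by (elim pcong_cancel_nat) (intro not_dvd_less; simp)
  then show ?thesis using assms by (simp only: sum_power_lessThan)
qed

lemma power_sum_pcong_0:
  assumes "0 < s" "s \<le> p - 2"
  shows "(\<Sum>t=1..p-1. of_nat t ^ s) \<cong>\<^bsub>1\<^esub> 0"
proof -
  have "(\<Sum>t=1..p-1. of_nat t ^ s) \<cong>\<^bsub>1\<^esub> of_nat p * bernoulli s"
    using power_sum_pcong[OF assms] by (rule pcong_antimono) simp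
  moreover have "of_nat p * bernoulli s \<in> I 1"
    using I_mult_0'[OF p_power_in_I[of 1 1] bernoulli_in_I] assms by simp
  ultimately have "(\<Sum>t=1..p-1. of_nat t ^ s) \<in> I 1"
    using pcong_I by blast
  then show ?thesis by (simp add: pcong_def)
qed

lemma fermat:
  assumes "\<not> p dvd t" shows "of_nat t ^ (p - 1) \<cong>\<^bsub>1\<^esub> 1"
proof -
  have "[t ^ (p - 1) = 1] (mod p)"
    using fermat_theorem prime assms by blast
  then have "int p dvd int (t ^ (p - 1)) - int 1"
    by (metis cong_iff_dvd_diff cong_int_iff)
  then have "of_int (int (t ^ (p - 1)) - int 1) \<in> I 1"
    by (intro I_of_int_dvd) simp
  then show ?thesis by (simp add: pcong_def)
qed

lemma inverse_power_in_I:
  assumes "0 < j" "j < p"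
  shows "1 / of_nat j ^ e \<in> I 0"
proof -
  have "\<not> p dvd j ^ e"
    using prime prime_dvd_power not_dvd_less[OF assms] by blast
  then have "1 / of_nat (j ^ e) \<in> I 0" by (rule I_inverse_nat)
  then show ?thesis by simp
qed

lemma I_divide_power:
  "x \<in> I f \<Longrightarrow> 0 < j \<Longrightarrow> j < p \<Longrightarrow> x / of_nat j ^ e \<in> I f"
  using I_mult_0'[OF _ inverse_power_in_I, of x f j e] by simp

lemma pcong_divide_power:
  "x \<cong>\<^bsub>f\<^esub> y \<Longrightarrow> 0 < j \<Longrightarrow> j < p \<Longrightarrow> x / of_nat j ^ e \<cong>\<^bsub>f\<^esub> y / of_nat j ^ e"
  using I_divide_power[of "x - y" f j e] by (simp add: pcong_def diff_divide_distrib)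

lemma inverse_power_pcong:
  assumes "0 < j" "j < p" "e \<le> p - 1"
  shows "1 / of_nat j ^ e \<cong>\<^bsub>1\<^esub> of_nat j ^ (p - 1 - e)"
proof -
  have "of_nat j ^ (p - 1) / of_nat j ^ e \<cong>\<^bsub>1\<^esub> 1 / of_nat j ^ e"
    by (intro pcong_divide_power fermat not_dvd_less assms)
  moreover have "of_nat j ^ (p - 1) / of_nat j ^ e = (of_nat j ^ (p - 1 - e) :: rat)"
    using assms by (simp add: power_diff)
  ultimately show ?thesis using pcong_sym by simp
qed

lemma hs_in_I: "n < p \<Longrightarrow> hs e n \<in> I 0"
  unfolding hs_def by (intro I_sum inverse_power_in_I) auto

lemma sum_half_split: "(\<Sum>t=1..p-1. f t) = (\<Sum>j=1..h. f j + f (p - j))"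
  for f :: "nat \<Rightarrow> rat"
proof -
  have "(\<Sum>t=1..p-1. f t) = (\<Sum>t=1..h. f t) + (\<Sum>t=h+1..h+h. f t)"
    unfolding p_minus_1 by (rule sum.ub_add_nat) simp
  also have "(\<Sum>t=h+1..h+h. f t) = (\<Sum>j=1..h. f (p - j))"
  proof (rule sum.reindex_bij_witness[of _ "\<lambda>j. p - j" "\<lambda>j. p - j"])
  qed (use p_eq in auto)
  finally show ?thesis by (simp add: sum.distrib)
qed

lemma sum_parity_split: "(\<Sum>t=1..p-1. f t) = (\<Sum>j=1..h. f (2 * j) + f (p - 2 * j))"
  for f :: "nat \<Rightarrow> rat"
proof -
  have "(\<Sum>t=1..2*n. f t) = (\<Sum>j=1..n. f (2 * j) + f (2 * j - 1))" for n
    by (induction n) (simp_all add: algebra_simps)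
  from this[of h] have "(\<Sum>t=1..p-1. f t) = (\<Sum>j=1..h. f (2 * j)) + (\<Sum>j=1..h. f (2 * j - 1))"
    unfolding p_minus_1 mult_2[symmetric] by (simp only: sum.distrib)
  also have "(\<Sum>j=1..h. f (2 * j - 1)) = (\<Sum>j=1..h. f (2 * (h + 1 - j) - 1))"
    by (subst sum.atLeastAtMost_rev) simp
  also have "\<dots> = (\<Sum>j=1..h. f (p - 2 * j))"
  proof (intro sum.cong refl arg_cong[of _ _ f])
    fix j assume "j \<in> {1..h}"
    then show "2 * (h + 1 - j) - 1 = p - 2 * j" using p_eq by auto
  qed
  finally show ?thesis by (simp add: sum.distrib)
qed

lemma p_in_I_1: "of_nat p \<in> I 1"
  using I_p_power[of 1] by simp

lemma inverse_square_reflect: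
  assumes "0 < j" "j < p"
  shows "1 / of_nat (p - j) ^ 2 \<cong>\<^bsub>2\<^esub> 1 / of_nat j ^ 2 + 2 * of_nat p / of_nat j ^ 3"
proof -
  define x y :: rat where "x = of_nat j" and "y = of_nat (p - j)"
  have y: "y = of_nat p - x" using assms by (simp add: x_def y_def of_nat_diff)
  have nz: "x \<noteq> 0" "of_nat p - x \<noteq> 0" using assms by (auto simp: x_def)
  have "1 / y ^ 2 - (1 / x ^ 2 + 2 * of_nat p / x ^ 3) = of_nat p ^ 2 * (3 * x - 2 * of_nat p) / x ^ 3 / y ^ 2"
    unfolding y using nz by (simp add: divide_simps) (simp add: eval_nat_numeral algebra_simps)
  moreover have "of_nat p ^ 2 * (3 * x - 2 * of_nat p) / x ^ 3 / y ^ 2 \<in> I 2"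
    unfolding x_def y_def using assms
    by (intro I_divide_power I_mult_0' I_p_power I_diff I_mult_0 I_numeral I_of_nat) auto
  ultimately show ?thesis
    unfolding pcong_def x_def y_def by argo
qed

lemma inverse_reflect:
  assumes "0 < j" "j < p"
  shows "1 / of_nat (p - j) \<cong>\<^bsub>1\<^esub> - (1 / of_nat j)"
proof -
  define x y :: rat where "x = of_nat j" and "y = of_nat (p - j)"
  have y: "y = of_nat p - x" using assms by (simp add: x_def y_def of_nat_diff)
  have nz: "x \<noteq> 0" "of_nat p - x \<noteq> 0" using assms by (auto simp: x_def)
  have "1 / y - - (1 / x) = of_nat p / x ^ 1 / y ^ 1"
    unfolding y using nz by (simp add: divide_simps)
  moreover have "of_nat p / x ^ 1 / y ^ 1 \<in> I 1"
    unfolding x_def y_def using assms by (intro I_divide_power p_in_I_1) auto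
  ultimately show ?thesis
    unfolding pcong_def x_def y_def by argo
qed

text \<open>Splitting the sum over all of \<open>1..p-1\<close> into halves and into parities gives two linear relations
  between the same quantities; the next evaluation of \<open>hs 3 h\<close> uses the same device.\<close>

lemma hs_2_half: "6 * hs 2 h \<cong>\<^bsub>2\<^esub> - 7 * of_nat p * hs 3 h"
proof -
  let ?A = "hs 2 (p - 1)" and ?P = "of_nat p :: rat"
  have "?A = (\<Sum>j=1..h. 1 / of_nat j ^ 2 + 1 / of_nat (p - j) ^ 2)"
    unfolding hs_def sum_half_split ..
  also have "\<dots> \<cong>\<^bsub>2\<^esub> (\<Sum>j=1..h. 1 / of_nat j ^ 2 + (1 / of_nat j ^ 2 + 2 * ?P / of_nat j ^ 3))"
    using h_less by (intro pcong_sum pcong_add pcong_refl inverse_square_reflect) auto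
  also have "\<dots> = 2 * hs 2 h + 2 * ?P * hs 3 h"
    by (simp add: hs_def sum.distrib sum_distrib_left)
  finally have 1: "?A \<cong>\<^bsub>2\<^esub> 2 * hs 2 h + 2 * ?P * hs 3 h" .
  have "?A = (\<Sum>j=1..h. 1 / of_nat (2 * j) ^ 2 + 1 / of_nat (p - 2 * j) ^ 2)"
    unfolding hs_def sum_parity_split ..
  also have "\<dots> \<cong>\<^bsub>2\<^esub> (\<Sum>j=1..h. 1 / of_nat (2 * j) ^ 2 + (1 / of_nat (2 * j) ^ 2 + 2 * ?P / of_nat (2 * j) ^ 3))"
    using h_less by (intro pcong_sum pcong_add pcong_refl inverse_square_reflect) auto
  also have "\<dots> = (\<Sum>j=1..h. (1 / 2) * (1 / of_nat j ^ 2) + (?P / 4) * (1 / of_nat j ^ 3))"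
    by (intro sum.cong refl) (simp add: power_mult_distrib)
  also have "\<dots> = (1 / 2) * hs 2 h + (?P / 4) * hs 3 h"
    by (simp only: hs_def sum.distrib sum_distrib_left)
  finally have "2 * hs 2 h + 2 * ?P * hs 3 h \<cong>\<^bsub>2\<^esub> (1 / 2) * hs 2 h + (?P / 4) * hs 3 h"
    using pcong_sym[OF 1] pcong_trans by blast
  then have "4 * (2 * hs 2 h + 2 * ?P * hs 3 h) \<cong>\<^bsub>2\<^esub> 4 * ((1 / 2) * hs 2 h + (?P / 4) * hs 3 h)"
    by (rule pcong_mult_left0) simp
  then show ?thesis
    unfolding pcong_def by (simp add: algebra_simps)
qed

lemma not_dvd_6: "\<not> p dvd 6"
proof
  assume "p dvd 6"
  then have "p dvd 2 * 3" by simp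
  then have "p dvd 2 \<or> p dvd 3" using prime by (simp only: prime_dvd_mult_iff)
  then show False using gt_3 by (auto dest!: dvd_imp_le)
qed

lemma p_mult_in_I: "x \<in> I e \<Longrightarrow> of_nat p * x \<in> I (Suc e)"
  using I_mult[OF p_in_I_1, of x e] by simp

lemma hs_2_half_0: "hs 2 h \<cong>\<^bsub>1\<^esub> 0"
proof -
  have "of_nat p * (- 7 * hs 3 h) \<in> I 1"
    using h_less p_mult_in_I[of "- 7 * hs 3 h" 0] by (simp add: hs_in_I I_mult_0 I_minus)
  then have "- 7 * of_nat p * hs 3 h \<in> I 1"
    by (simp add: mult_ac)
  moreover have "6 * hs 2 h \<cong>\<^bsub>1\<^esub> - 7 * of_nat p * hs 3 h"
    using hs_2_half by (rule pcong_antimono) simp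
  ultimately have "6 * hs 2 h \<in> I 1"
    using pcong_I by blast
  then have "of_nat 6 * hs 2 h \<cong>\<^bsub>1\<^esub> of_nat 6 * 0"
    by (simp add: pcong_def)
  then show ?thesis
    using not_dvd_6 by (rule pcong_cancel_nat)
qed

lemma pcong_power_expand:
  assumes "x \<in> I 0" "y \<in> I 1"
  shows "(x + y) ^ Suc e \<cong>\<^bsub>2\<^esub> x ^ Suc e + of_nat (Suc e) * x ^ e * y"
proof (induction e)
  case (Suc e)
  have y: "y \<in> I 0" using assms(2) by (rule I_antimono) simp
  have "(x + y) * (x + y) ^ Suc e \<cong>\<^bsub>2\<^esub> (x + y) * (x ^ Suc e + of_nat (Suc e) * x ^ e * y)"
    using Suc by (rule pcong_mult_left0) (intro I_add assms y)
  also have "\<dots> \<cong>\<^bsub>2\<^esub> x ^ Suc (Suc e) + of_nat (Suc (Suc e)) * x ^ Suc e * y"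
  proof -
    have "(x + y) * (x ^ Suc e + of_nat (Suc e) * x ^ e * y) - (x ^ Suc (Suc e) + of_nat (Suc (Suc e)) * x ^ Suc e * y)
       = of_nat (Suc e) * x ^ e * y ^ 2"
      by (simp add: algebra_simps power2_eq_square)
    also have "\<dots> \<in> I 2"
      using I_power[OF assms(2), of 2] by (intro I_mult_0 I_of_nat I_power_0 assms) simp
    finally show ?thesis by (simp only: pcong_def)
  qed
  finally show ?case by simp
qed (simp add: pcong_def)

lemma hs_3_half: "hs 3 h \<cong>\<^bsub>1\<^esub> - 2 * bernoulli (p - 3)"
proof -
  \<comment> \<open>The exponent p - 3 = e + 1 brings in B_{p-3}; reflecting t to p - t lowers it to
    e, and j^e is 1/j^3 modulo p by Fermat.\<close>
  define e where "e = p - 4"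
  have e: "p - 3 = Suc e" "even (Suc e)" "p - 1 = e + 3"
    using gt_3 odd_p by (auto simp: e_def)
  let ?P = "of_nat p :: rat" and ?s = "of_nat (Suc e) :: rat" and ?B = "bernoulli (p - 3)"
  define Q R :: rat where "Q = (\<Sum>j=1..h. of_nat j ^ Suc e)" and "R = (\<Sum>j=1..h. of_nat j ^ e)"
  define S :: rat where "S = (\<Sum>t=1..p-1. of_nat t ^ Suc e)"
  have RI: "R \<in> I 0" unfolding R_def by (intro I_sum I_power_0 I_of_nat)
  have BI: "?B \<in> I 0" by (rule bernoulli_in_I) simp
  have SB: "S \<cong>\<^bsub>2\<^esub> ?P * ?B"
    unfolding S_def e(1) using gt_3 by (intro power_sum_pcong) (auto simp: e_def)
  have refl: "of_nat (p - j) ^ Suc e \<cong>\<^bsub>2\<^esub> of_nat j ^ Suc e - ?s * ?P * of_nat j ^ e" if "j \<le> p" for j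
  proof -
    have "of_nat (p - j) ^ Suc e = (of_nat j + - ?P) ^ Suc e"
      using that e(2) power_minus_even[of "Suc e" "of_nat j + - ?P"] by (simp add: of_nat_diff del: power_Suc)
    also have "\<dots> \<cong>\<^bsub>2\<^esub> of_nat j ^ Suc e + ?s * of_nat j ^ e * - ?P"
      by (intro pcong_power_expand I_of_nat I_minus p_in_I_1)
    finally show ?thesis by (simp add: algebra_simps)
  qed
  have "S = (\<Sum>j=1..h. of_nat j ^ Suc e + of_nat (p - j) ^ Suc e)"
    unfolding S_def sum_half_split ..
  also have "\<dots> \<cong>\<^bsub>2\<^esub> (\<Sum>j=1..h. of_nat j ^ Suc e + (of_nat j ^ Suc e - ?s * ?P * of_nat j ^ e))"
    using h_less by (intro pcong_sum pcong_add pcong_refl refl) auto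
  also have "\<dots> = 2 * Q - ?s * ?P * R"
    by (simp add: Q_def R_def sum.distrib sum_subtractf sum_distrib_left del: power_Suc of_nat_Suc)
  finally have 1: "S \<cong>\<^bsub>2\<^esub> 2 * Q - ?s * ?P * R" .
  have "S = (\<Sum>j=1..h. of_nat (2 * j) ^ Suc e + of_nat (p - 2 * j) ^ Suc e)"
    unfolding S_def sum_parity_split ..
  also have "\<dots> \<cong>\<^bsub>2\<^esub> (\<Sum>j=1..h. of_nat (2 * j) ^ Suc e + (of_nat (2 * j) ^ Suc e - ?s * ?P * of_nat (2 * j) ^ e))"
    using h_less by (intro pcong_sum pcong_add pcong_refl refl) auto
  also have "\<dots> = (\<Sum>j=1..h. 2 * 2 ^ Suc e * of_nat j ^ Suc e - ?s * ?P * 2 ^ e * of_nat j ^ e)"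
    by (intro sum.cong refl) (simp only: of_nat_mult power_mult_distrib of_nat_numeral, simp add: algebra_simps)
  also have "\<dots> = 2 * 2 ^ Suc e * Q - ?s * ?P * 2 ^ e * R"
    by (simp only: Q_def R_def sum_subtractf sum_distrib_left)
  finally have 2: "S \<cong>\<^bsub>2\<^esub> 2 * 2 ^ Suc e * Q - ?s * ?P * 2 ^ e * R" .
  \<comment> \<open>This combination eliminates \<open>Q\<close>, of which no value modulo p^2 is at
    hand.\<close>
  have "2 ^ Suc e * S - S \<cong>\<^bsub>2\<^esub> 2 ^ Suc e * (2 * Q - ?s * ?P * R) - (2 * 2 ^ Suc e * Q - ?s * ?P * 2 ^ e * R)"
    using 1 2 by (intro pcong_diff pcong_mult_left0 I_power_0 I_numeral)
  then have "(2 ^ Suc e - 1) * S \<cong>\<^bsub>2\<^esub> ?P * (- ?s * 2 ^ e * R)"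
    by (simp add: algebra_simps)
  moreover have "(2 ^ Suc e - 1) * S \<cong>\<^bsub>2\<^esub> (2 ^ Suc e - 1) * (?P * ?B)"
    using SB by (intro pcong_mult_left0 I_diff I_power_0 I_numeral)
  ultimately have "(2 ^ Suc e - 1) * (?P * ?B) \<cong>\<^bsub>2\<^esub> ?P * (- ?s * 2 ^ e * R)"
    using pcong_sym pcong_trans by blast
  then have "?P ^ 1 * ((2 ^ Suc e - 1) * ?B) \<cong>\<^bsub>1 + 1\<^esub> ?P ^ 1 * (- ?s * 2 ^ e * R)"
    by (simp add: mult_ac numeral_2_eq_2)
  then have "(2 ^ Suc e - 1) * ?B \<cong>\<^bsub>1\<^esub> - ?s * 2 ^ e * R"
    by (rule pcong_cancel_p_power)
  \<comment> \<open>The factor 8 turns 2^(p-4) into 2^(p-1), which Fermat replaces by 1.\<close>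
  then have 3: "8 * ((2 ^ Suc e - 1) * ?B) \<cong>\<^bsub>1\<^esub> 8 * (- ?s * 2 ^ e * R)"
    by (rule pcong_mult_left0) simp
  have two: "2 ^ (p - 1) \<cong>\<^bsub>1\<^esub> 1"
    using fermat[OF not_dvd_2] by simp
  have e8: "(8 :: rat) * 2 ^ e = 2 ^ (p - 1)"
    unfolding e(3) by (simp add: power_add)
  have "8 * ((2 ^ Suc e - 1) * ?B) = ?B * (2 * 2 ^ (p - 1) - 8)"
    unfolding e8[symmetric] by (simp add: algebra_simps)
  also have "\<dots> \<cong>\<^bsub>1\<^esub> ?B * (2 * 1 - 8)"
    using two BI by (intro pcong_mult_left0 pcong_diff pcong_refl I_numeral)
  finally have 4: "8 * ((2 ^ Suc e - 1) * ?B) \<cong>\<^bsub>1\<^esub> - 6 * ?B" by (simp add: mult.commute)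
  have "8 * (- ?s * 2 ^ e * R) = (- ?s * R) * 2 ^ (p - 1)"
    unfolding e8[symmetric] by simp
  also have "\<dots> \<cong>\<^bsub>1\<^esub> (- ?s * R) * 1"
    using two RI by (intro pcong_mult_left0 I_mult_0 I_minus I_of_nat)
  also have "\<dots> \<cong>\<^bsub>1\<^esub> 3 * R"
  proof -
    have s: "?s = ?P - 3" using gt_3 by (simp add: e_def of_nat_diff)
    have "(- ?s * R) * 1 - 3 * R = - (?P * R)"
      unfolding s by (simp add: algebra_simps)
    then show ?thesis
      using RI p_mult_in_I[of R 0] by (simp add: pcong_def I_minus)
  qed
  finally have "- 6 * ?B \<cong>\<^bsub>1\<^esub> 3 * R"
    using 3 4 pcong_sym pcong_trans by blast
  then have "of_nat 3 * R \<cong>\<^bsub>1\<^esub> of_nat 3 * (- 2 * ?B)"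
    using pcong_sym by simp
  moreover have "\<not> p dvd 3" using gt_3 by (auto dest!: dvd_imp_le)
  ultimately have "R \<cong>\<^bsub>1\<^esub> - 2 * ?B"
    by (rule pcong_cancel_nat)
  moreover have "hs 3 h \<cong>\<^bsub>1\<^esub> R"
    unfolding hs_def R_def
  proof (rule pcong_sum)
    fix j assume "j \<in> {1..h}"
    then show "1 / of_nat j ^ 3 \<cong>\<^bsub>1\<^esub> of_nat j ^ e"
      using inverse_power_pcong[of j 3] h_less by (auto simp: e_def)
  qed
  ultimately show ?thesis using pcong_trans by blast
qed

lemma hs_1_p_minus_1: "hs 1 (p - 1) \<cong>\<^bsub>1\<^esub> 0"
proof -
  have "hs 1 (p - 1) = (\<Sum>j=1..h. 1 / of_nat j + 1 / of_nat (p - j))"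
    unfolding hs_def sum_half_split by simp
  also have "\<dots> \<cong>\<^bsub>1\<^esub> (\<Sum>j=1..h. 1 / of_nat j + - (1 / of_nat j))"
    using h_less by (intro pcong_sum pcong_add pcong_refl inverse_reflect) auto
  finally show ?thesis by simp
qed

lemma hs_1_reflect: "j < p \<Longrightarrow> hs 1 (p - 1 - j) \<cong>\<^bsub>1\<^esub> hs 1 j"
proof (induction j)
  case 0
  then show ?case using hs_1_p_minus_1 by simp
next
  case (Suc j)
  have "p - 1 - j = Suc (p - 1 - Suc j)" "Suc (p - 1 - Suc j) = p - Suc j" using Suc.prems by auto
  then have "hs 1 (p - 1 - Suc j) = hs 1 (p - 1 - j) - 1 / of_nat (p - Suc j)"
    using hs_Suc[of 1 "p - 1 - Suc j"] by simp
  also have "\<dots> \<cong>\<^bsub>1\<^esub> hs 1 j - - (1 / of_nat (Suc j))"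
    using Suc by (intro pcong_diff inverse_reflect) auto
  finally show ?case by (simp add: hs_Suc)
qed

lemma inverse_square_reflect_1:
  assumes "0 < j" "j < p"
  shows "1 / of_nat (p - j) ^ 2 \<cong>\<^bsub>1\<^esub> 1 / of_nat j ^ 2"
proof -
  have "1 / of_nat (p - j) ^ 2 \<cong>\<^bsub>1\<^esub> 1 / of_nat j ^ 2 + 2 * of_nat p / of_nat j ^ 3"
    using inverse_square_reflect[OF assms] by (rule pcong_antimono) simp
  also have "\<dots> \<cong>\<^bsub>1\<^esub> 1 / of_nat j ^ 2 + 0"
  proof (intro pcong_add pcong_refl)
    have "2 * of_nat p / of_nat j ^ 3 \<in> I 1"
      using assms by (intro I_divide_power I_mult_0 p_in_I_1 I_numeral)
    then show "2 * of_nat p / of_nat j ^ 3 \<cong>\<^bsub>1\<^esub> 0" by (simp add: pcong_def)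
  qed
  finally show ?thesis by simp
qed

text \<open>The upper half is folded by b -> p - b with \<open>hs_1_reflect\<close>. This produces
  \<open>hs 1 j\<close> instead of \<open>hs 1 (j - 1)\<close>, and the difference 1/j is the source
  of \<open>hs 3 h\<close>.\<close>

lemma hs12_double: "hs12 (p - 1) \<cong>\<^bsub>1\<^esub> 2 * hs12 h + hs 3 h"
proof -
  have "hs12 (p - 1) = (\<Sum>j=1..h. hs 1 (j - 1) / of_nat j ^ 2 + hs 1 (p - j - 1) * (1 / of_nat (p - j) ^ 2))"
    unfolding hs12_def sum_half_split by simp
  also have "\<dots> \<cong>\<^bsub>1\<^esub> (\<Sum>j=1..h. hs 1 (j - 1) / of_nat j ^ 2 + hs 1 j * (1 / of_nat j ^ 2))"
  proof (intro pcong_sum pcong_add pcong_refl pcong_mult)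
    fix j assume j: "j \<in> {1..h}"
    have "p - j - 1 = p - 1 - j" by simp
    then show "hs 1 (p - j - 1) \<cong>\<^bsub>1\<^esub> hs 1 j"
      using hs_1_reflect[of j] j h_less by simp
    show "1 / of_nat (p - j) ^ 2 \<cong>\<^bsub>1\<^esub> 1 / of_nat j ^ 2"
      using j h_less by (intro inverse_square_reflect_1) auto
    show "hs 1 (p - j - 1) \<in> I 0" by (rule hs_in_I) (use j in auto)
    show "1 / of_nat j ^ 2 \<in> I 0" using j h_less by (intro inverse_power_in_I) auto
  qed
  also have "\<dots> = (\<Sum>j=1..h. 2 * (hs 1 (j - 1) / of_nat j ^ 2) + 1 / of_nat j ^ 3)"
  proof (intro sum.cong refl)
    fix j assume "j \<in> {1..h}"
    then obtain i where "j = Suc i" by (cases j) auto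
    then show "hs 1 (j - 1) / of_nat j ^ 2 + hs 1 j * (1 / of_nat j ^ 2)
        = 2 * (hs 1 (j - 1) / of_nat j ^ 2) + 1 / of_nat j ^ 3"
      by (simp add: hs_Suc add_divide_distrib power2_eq_square power3_eq_cube del: of_nat_Suc)
  qed
  also have "\<dots> = 2 * hs12 h + hs 3 h"
    by (simp only: hs12_def hs_def sum.distrib sum_distrib_left)
  finally show ?thesis .
qed

text \<open>The exponent e - 2 runs from -1 to p - 3, where 0 is the only multiple of p - 1.\<close>

lemma power_quotient_sum:
  assumes "1 \<le> e" "e \<le> p - 1"
  shows "(\<Sum>b=1..p-1. of_nat b ^ e / of_nat b ^ 2) \<cong>\<^bsub>1\<^esub> (if e = 2 then - 1 else 0)"
proof -
  consider "e = 1" | "e = 2" | "e \<ge> 3" using assms by linarith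
  then show ?thesis
  proof cases
    case 1
    then have "(\<Sum>b=1..p-1. of_nat b ^ e / of_nat b ^ 2) = hs 1 (p - 1)"
      by (simp add: hs_def power2_eq_square)
    with 1 hs_1_p_minus_1 show ?thesis by simp
  next
    case 2
    then have "(\<Sum>b=1..p-1. of_nat b ^ e / of_nat b ^ 2) = (\<Sum>b=1..p-1. 1 :: rat)"
      by (intro sum.cong) auto
    also have "\<dots> = of_nat p - 1" by (simp add: of_nat_diff Suc_le_eq)
    finally show ?thesis using 2 p_in_I_1 by (simp add: pcong_def)
  next
    case 3
    have "(\<Sum>b=1..p-1. of_nat b ^ e / of_nat b ^ 2) = (\<Sum>b=1..p-1. of_nat b ^ (e - 2) :: rat)"
      using 3 by (intro sum.cong refl) (auto simp: power_diff)
    then show ?thesis using 3 power_sum_pcong_0[of "e - 2"] assms by simp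
  qed
qed

text \<open>By Fermat and Faulhaber, \<open>hs 1 (b - 1)\<close> is a polynomial in b modulo p.
  Dividing by b^2 and summing over b leaves only its b^2 coefficient, which carries B_{p-3}.\<close>

lemma hs12_p_minus_1: "hs12 (p - 1) \<cong>\<^bsub>1\<^esub> bernoulli (p - 3)"
proof -
  let ?c = "\<lambda>i. of_nat ((p - 1) choose i) * bernoulli i :: rat"
  have c: "?c i \<in> I 0" if "i \<le> p - 2" for i
    using that by (intro I_mult_0 I_of_nat bernoulli_in_I)
  have p2: "p - 2 + 1 = p - 1" using gt_3 by simp
  have hs: "of_nat (p - 1) * hs 1 (b - 1) \<cong>\<^bsub>1\<^esub> (\<Sum>i\<le>p-2. ?c i * of_nat b ^ (p - 1 - i))"
    if b: "b \<in> {1..p-1}" for b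
  proof -
    have "hs 1 (b - 1) \<cong>\<^bsub>1\<^esub> (\<Sum>a=1..b-1. of_nat a ^ (p - 2))"
      unfolding hs_def
    proof (rule pcong_sum)
      fix a assume "a \<in> {1..b-1}"
      moreover have "p - 1 - 1 = p - 2" by simp
      ultimately show "1 / of_nat a ^ 1 \<cong>\<^bsub>1\<^esub> of_nat a ^ (p - 2)"
        using inverse_power_pcong[of a 1] b by auto
    qed
    also have "(\<Sum>a=1..b-1. of_nat a ^ (p - 2)) = (\<Sum>a<b. of_nat a ^ (p - 2) :: rat)"
    proof -
      have "{..<b} = insert 0 {1..b-1}" using b by auto
      then show ?thesis using gt_3 by simp
    qed
    finally have "of_nat (p - 1) * hs 1 (b - 1) \<cong>\<^bsub>1\<^esub> of_nat (p - 1) * (\<Sum>a<b. of_nat a ^ (p - 2))"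
      by (rule pcong_mult_left0) (rule I_of_nat)
    also have "\<dots> = (\<Sum>i\<le>p-2. ?c i * of_nat b ^ (p - 1 - i))"
      using faulhaber[of "p - 2" b] unfolding p2 .
    finally show ?thesis .
  qed
  have "of_nat (p - 1) * hs12 (p - 1) = (\<Sum>b=1..p-1. of_nat (p - 1) * hs 1 (b - 1) / of_nat b ^ 2)"
    by (simp add: hs12_def sum_distrib_left)
  also have "\<dots> \<cong>\<^bsub>1\<^esub> (\<Sum>b=1..p-1. (\<Sum>i\<le>p-2. ?c i * of_nat b ^ (p - 1 - i)) / of_nat b ^ 2)"
    by (intro pcong_sum pcong_divide_power hs) auto
  also have "\<dots> = (\<Sum>i\<le>p-2. ?c i * (\<Sum>b=1..p-1. of_nat b ^ (p - 1 - i) / of_nat b ^ 2))"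
    unfolding sum_divide_distrib sum_distrib_left by (subst sum.swap) simp
  also have "\<dots> \<cong>\<^bsub>1\<^esub> (\<Sum>i\<le>p-2. ?c i * (if p - 1 - i = 2 then - 1 else 0))"
    by (intro pcong_sum pcong_mult_left0 power_quotient_sum c) (use gt_3 in auto)
  also have "\<dots> = (\<Sum>i\<le>p-2. if i = p - 3 then - ?c (p - 3) else 0)"
    by (intro sum.cong refl) (use gt_3 in auto)
  also have "\<dots> = - ?c (p - 3)"
    by simp
  finally have 1: "of_nat (p - 1) * hs12 (p - 1) \<cong>\<^bsub>1\<^esub> - ?c (p - 3)" .
  \<comment> \<open>Doubling avoids a division: twice the binomial coefficient is (p-1)(p-2), and
    the second factor is -2 modulo p.\<close>
  have "2 * (of_nat (p - 1) * hs12 (p - 1)) \<cong>\<^bsub>1\<^esub> 2 * - ?c (p - 3)"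
    using 1 by (rule pcong_mult_left0) simp
  also have "2 * - ?c (p - 3) = of_nat (p - 1) * ((2 - of_nat p) * bernoulli (p - 3))"
  proof -
    have "(p - 1) choose (p - 3) = (p - 1) choose 2"
      using gt_3 binomial_symmetric[of "p - 3" "p - 1"] by simp
    moreover have "2 * ((p - 1) choose 2) = (p - 1) * (p - 2)"
    proof -
      have "even ((p - 1) * (p - 1 - 1))" by simp
      then have "2 * ((p - 1) choose 2) = (p - 1) * (p - 1 - 1)"
        unfolding choose_two by (rule dvd_mult_div_cancel)
      moreover have "p - 1 - 1 = p - 2" by simp
      ultimately show ?thesis by simp
    qed
    ultimately have "2 * of_nat ((p - 1) choose (p - 3)) = (of_nat ((p - 1) * (p - 2)) :: rat)"
      by (metis of_nat_mult of_nat_numeral)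
    moreover have "of_nat ((p - 1) * (p - 2)) = (of_nat (p - 1) * (of_nat p - 2) :: rat)"
      using gt_3 by (simp add: of_nat_diff)
    ultimately have "2 * - ?c (p - 3) = - (of_nat (p - 1) * (of_nat p - 2) * bernoulli (p - 3))"
      by (metis minus_mult_right mult.assoc)
    then show ?thesis by (simp add: algebra_simps)
  qed
  finally have "of_nat (p - 1) * (2 * hs12 (p - 1)) \<cong>\<^bsub>1\<^esub> of_nat (p - 1) * ((2 - of_nat p) * bernoulli (p - 3))"
    by (simp add: mult_ac)
  moreover have "\<not> p dvd p - 1" using gt_3 by (intro not_dvd_less) auto
  ultimately have "2 * hs12 (p - 1) \<cong>\<^bsub>1\<^esub> (2 - of_nat p) * bernoulli (p - 3)"
    by (rule pcong_cancel_nat)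
  also have "\<dots> \<cong>\<^bsub>1\<^esub> 2 * bernoulli (p - 3)"
    using p_mult_in_I[OF bernoulli_in_I, of "p - 3"] by (simp add: pcong_def algebra_simps I_minus)
  finally have "of_nat 2 * hs12 (p - 1) \<cong>\<^bsub>1\<^esub> of_nat 2 * bernoulli (p - 3)" by simp
  then show ?thesis using not_dvd_2 by (rule pcong_cancel_nat)
qed

text \<open>\<open>hs_stuffle\<close> removes \<open>hs21\<close>, and \<open>hs 2 h\<close>
  vanishes modulo p. With B = B_{p-3} the rest is B - 3(-2B).\<close>

lemma hconv_half: "2 * hconv h \<cong>\<^bsub>1\<^esub> 7 * bernoulli (p - 3)"
proof -
  have "2 * hconv h = (2 * hs12 h + hs 3 h) - 3 * hs 3 h + 2 * hs 1 h * hs 2 h"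
    using hs_stuffle[of h] by (simp add: hconv_eq algebra_simps)
  also have "\<dots> \<cong>\<^bsub>1\<^esub> bernoulli (p - 3) - 3 * (- 2 * bernoulli (p - 3)) + 2 * hs 1 h * 0"
  proof (intro pcong_add pcong_diff pcong_mult_left0 hs_3_half hs_2_half_0)
    show "2 * hs12 h + hs 3 h \<cong>\<^bsub>1\<^esub> bernoulli (p - 3)"
      using pcong_trans[OF pcong_sym[OF hs12_double] hs12_p_minus_1] .
  qed (use hs_in_I h_less in \<open>auto intro!: I_mult_0\<close>)
  finally show ?thesis by simp
qed

section \<open>Exponent 1: the error term as a linear coefficient, and the constant\<close>

lemma coeff_phi_poly_in_I: "k < p \<Longrightarrow> Polynomial.coeff (phi_poly k) e \<in> I 0"
proof (induction k arbitrary: e)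
  case 0
  show ?case by (cases e) (simp_all add: phi_poly_def)
next
  case (Suc k)
  define a b :: rat where "a = (of_nat (2 * Suc k - 1))\<^sup>2 / (of_nat (2 * Suc k))\<^sup>2"
    and "b = - 1 / (of_nat (2 * Suc k))\<^sup>2"
  have nd: "\<not> p dvd Suc k" using Suc.prems by (intro not_dvd_less) auto
  have "a \<in> I 0"
    unfolding a_def using nd by (intro I_divide_double_square I_power_0 I_of_nat)
  moreover have "b \<in> I 0"
    unfolding b_def by (rule I_divide_double_square[OF I_minus[OF I_numeral(2)] nd])
  moreover have "phi_poly (Suc k) = [:a, b:] * phi_poly k"
    unfolding phi_poly_def a_def b_def by (rule prod.nat_ivl_Suc') simp
  ultimately show ?case
    using Suc by (cases e) (auto simp: coeff_pCons intro!: I_add I_mult_0)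
qed

text \<open>Built for its linear coefficient: modulo suitable powers of p,
  \<open>phi_diff 1 k\<close> is -p^2 times that of \<open>phi_poly k\<close>, and twice the weight
  is -p/k.\<close>

definition h_poly :: "rat poly" where
  "h_poly = (\<Sum>k=1..h. Polynomial.smult (1 / of_nat k) (phi_poly k))"

lemma degree_h_poly: "degree h_poly \<le> h"
  unfolding h_poly_def
  by (intro degree_sum_le) (auto intro: order.trans[OF degree_smult_le] order.trans[OF degree_phi_poly])

lemma coeff_h_poly: "Polynomial.coeff h_poly e = (\<Sum>k=1..h. Polynomial.coeff (phi_poly k) e / of_nat k)"
  by (simp add: h_poly_def coeff_sum)

lemma coeff_h_poly_in_I: "Polynomial.coeff h_poly e \<in> I 0"
  unfolding coeff_h_poly using h_less
  by (intro I_sum I_divide_nat coeff_phi_poly_in_I not_dvd_less) auto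

text \<open>At the j-th odd square \<open>phi\<close> vanishes for k > j, so the sum stops at j and
  \<open>sum_phi_over_index\<close> applies.\<close>

lemma poly_h_poly:
  assumes "j \<le> h" shows "poly h_poly ((2 * of_nat j + 1)\<^sup>2) = - 2 * hs 1 j"
proof -
  have "poly h_poly ((2 * of_nat j + 1)\<^sup>2) = (\<Sum>k=1..h. phi ((2 * of_nat j + 1)\<^sup>2) k / of_nat k)"
    by (simp add: h_poly_def poly_sum poly_phi_poly)
  also have "\<dots> = (\<Sum>k=1..j. phi ((2 * of_nat j + 1)\<^sup>2) k / of_nat k)"
    using assms by (intro sum.mono_neutral_right) (auto simp: phi_odd_eq_0)
  also have "\<dots> = - 2 * hs 1 j" by (rule sum_phi_over_index)
  finally show ?thesis .
qed

lemma even_power_sum_half: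
  assumes "0 < s" "s < h"
  shows "(\<Sum>i=1..h. of_nat i ^ (2 * s)) \<cong>\<^bsub>1\<^esub> 0"
proof -
  have "(\<Sum>t=1..p-1. of_nat t ^ (2 * s)) = (\<Sum>i=1..h. of_nat i ^ (2 * s) + of_nat (p - i) ^ (2 * s) :: rat)"
    by (rule sum_half_split)
  also have "\<dots> \<cong>\<^bsub>1\<^esub> (\<Sum>i=1..h. of_nat i ^ (2 * s) + of_nat i ^ (2 * s))"
  proof (intro pcong_sum pcong_add pcong_refl)
    fix i assume i: "i \<in> {1..h}"
    have "of_nat (p - i) ^ 2 \<cong>\<^bsub>1\<^esub> of_nat i ^ 2"
    proof -
      have "of_nat (p - i) ^ 2 - of_nat i ^ 2 = (of_nat p * (of_nat p - 2 * of_nat i) :: rat)"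
        using i h_less by (simp add: of_nat_diff power2_eq_square algebra_simps)
      also have "\<dots> \<in> I 1"
        by (intro I_mult_0' p_in_I_1 I_diff I_mult_0 I_of_nat I_numeral)
      finally show ?thesis by (simp only: pcong_def)
    qed
    then have "(\<Prod>j<s. of_nat (p - i) ^ 2) \<cong>\<^bsub>1\<^esub> (\<Prod>j<s. of_nat i ^ 2)"
      by (intro pcong_prod I_power_0 I_of_nat)
    then show "of_nat (p - i) ^ (2 * s) \<cong>\<^bsub>1\<^esub> of_nat i ^ (2 * s)"
      by (simp add: power_mult)
  qed
  also have "\<dots> = of_nat 2 * (\<Sum>i=1..h. of_nat i ^ (2 * s))"
    by (simp add: sum.distrib sum_distrib_left)
  finally have *: "(\<Sum>t=1..p-1. of_nat t ^ (2 * s)) \<cong>\<^bsub>1\<^esub> of_nat 2 * (\<Sum>i=1..h. of_nat i ^ (2 * s))" .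
  have "(\<Sum>t=1..p-1. of_nat t ^ (2 * s)) \<cong>\<^bsub>1\<^esub> 0"
    using assms h_less p_minus_1 by (intro power_sum_pcong_0) auto
  then have "of_nat 2 * (\<Sum>i=1..h. of_nat i ^ (2 * s)) \<cong>\<^bsub>1\<^esub> of_nat 2 * 0"
    using pcong_trans[OF pcong_sym[OF *]] by simp
  then show ?thesis using not_dvd_2 by (rule pcong_cancel_nat)
qed

text \<open>The squares \<open>(p - 2 * i)\<^sup>2\<close> run over the nonzero squares modulo \<open>p\<close>, so the power sums
  over them isolate the linear coefficient, while at these points the polynomial is a harmonic number.\<close>

lemma coeff_1_h_poly: "Polynomial.coeff h_poly 1 \<cong>\<^bsub>1\<^esub> hconv h"
proof -
  let ?X = "\<lambda>i. of_nat (p - 2 * i) ^ 2 :: rat" and ?Y = "\<lambda>i. of_nat (2 * i) ^ 2 :: rat"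
  have i: "0 < 2 * i" "2 * i < p" "0 < p - 2 * i" "p - 2 * i < p" "2 * i \<le> p" if "i \<in> {1..h}" for i
    using that h_less by auto
  have X: "?X i \<cong>\<^bsub>1\<^esub> ?Y i" if "i \<in> {1..h}" for i
  proof -
    have "?X i - ?Y i = of_nat p * (of_nat p - 2 * of_nat (2 * i))"
      using i[OF that] by (simp add: of_nat_diff power2_eq_square algebra_simps)
    also have "\<dots> \<in> I 1"
      by (intro I_mult_0' p_in_I_1 I_diff I_mult_0 I_of_nat I_numeral)
    finally show ?thesis by (simp only: pcong_def)
  qed
  have X0: "?X i \<noteq> 0" if "i \<in> {1..h}" for i
    using i(3)[OF that] by (simp del: of_nat_diff)
  have X': "1 / ?X i \<cong>\<^bsub>1\<^esub> 1 / ?Y i" if "i \<in> {1..h}" for i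
    using inverse_square_reflect_1[of "2 * i"] i[OF that] by simp
  have four: "(\<Sum>i=1..h. f i * (1 / ?Y i)) = (\<Sum>i=1..h. f i / of_nat i ^ 2) / of_nat 4" for f
    by (simp add: sum_divide_distrib power_mult_distrib mult.commute)
  have "(\<Sum>i=1..h. poly h_poly (?X i) * (1 / ?X i)) = (\<Sum>i=1..h. (- 2 * hs 1 (h - i)) * (1 / ?X i))"
  proof (intro sum.cong refl)
    fix i assume "i \<in> {1..h}"
    \<comment> \<open>The representative p - 2i is used because it is odd:
      \<open>poly_h_poly\<close> evaluates exactly there. Only the factor 1/X is reduced to the
      residue (2i)^2.\<close>
    then have "p - 2 * i = 2 * (h - i) + 1" using p_eq by auto
    then show "poly h_poly (?X i) * (1 / ?X i) = (- 2 * hs 1 (h - i)) * (1 / ?X i)"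
      using poly_h_poly[of "h - i"] by (simp add: add.commute)
  qed
  also have "\<dots> \<cong>\<^bsub>1\<^esub> (\<Sum>i=1..h. (- 2 * hs 1 (h - i)) * (1 / ?Y i))"
    using h_less by (intro pcong_sum pcong_mult_left0 X' I_mult_0 hs_in_I) auto
  also have "\<dots> = - 2 * hconv h / of_nat 4"
    unfolding four by (simp add: hconv_def sum_distrib_left sum_divide_distrib sum_negf)
  finally have lhs: "(\<Sum>i=1..h. poly h_poly (?X i) * (1 / ?X i)) \<cong>\<^bsub>1\<^esub> - 2 * hconv h / of_nat 4" .
  \<comment> \<open>The sum of X^(e-1) over the nonzero squares. The exponent lies between -1 and h
    - 1, so only e = 1 survives; e = 0 is the vanishing of \<open>hs 2 h\<close>.\<close>
  have pow: "(\<Sum>i=1..h. ?X i ^ e * (1 / ?X i)) \<cong>\<^bsub>1\<^esub> (if e = 1 then of_nat h else 0)" if "e \<le> h" for e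
  proof -
    consider "e = 0" | "e = 1" | "e \<ge> 2" by linarith
    then show ?thesis
    proof cases
      case 1
      then have "(\<Sum>i=1..h. ?X i ^ e * (1 / ?X i)) = (\<Sum>i=1..h. 1 / ?X i)" by simp
      also have "\<dots> \<cong>\<^bsub>1\<^esub> (\<Sum>i=1..h. 1 / ?Y i)"
        by (intro pcong_sum X')
      also have "\<dots> = hs 2 h / of_nat 4"
        using four[of "\<lambda>_. 1"] by (simp add: hs_def)
      also have "\<dots> \<cong>\<^bsub>1\<^esub> 0"
      proof -
        have "\<not> p dvd 4" using not_dvd_mult[OF not_dvd_2 not_dvd_2] by simp
        then show ?thesis using hs_2_half_0 I_divide_nat[of "hs 2 h" 1 4] by (simp add: pcong_def)
      qed
      finally show ?thesis using 1 by simp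
    next
      case 2
      then have "(\<Sum>i=1..h. ?X i ^ e * (1 / ?X i)) = (\<Sum>i=1..h. 1)"
        using X0 by (intro sum.cong refl) auto
      with 2 show ?thesis by simp
    next
      case 3
      have "(\<Sum>i=1..h. ?X i ^ e * (1 / ?X i)) = (\<Sum>i=1..h. \<Prod>j<e - 1. ?X i)"
        using X0 3 by (intro sum.cong refl) (simp add: power_diff)
      also have "\<dots> \<cong>\<^bsub>1\<^esub> (\<Sum>i=1..h. \<Prod>j<e - 1. ?Y i)"
        by (intro pcong_sum pcong_prod X I_power_0 I_of_nat)
      also have "\<dots> = 2 ^ (2 * (e - 1)) * (\<Sum>i=1..h. of_nat i ^ (2 * (e - 1)))"
        by (simp add: sum_distrib_left power_mult_distrib power_mult)
      also have "\<dots> \<cong>\<^bsub>1\<^esub> 2 ^ (2 * (e - 1)) * 0"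
        using that 3 by (intro pcong_mult_left0 even_power_sum_half I_power_0 I_numeral) auto
      finally show ?thesis using 3 by simp
    qed
  qed
  have "(\<Sum>i=1..h. poly h_poly (?X i) * (1 / ?X i)) = (\<Sum>e\<le>h. Polynomial.coeff h_poly e * (\<Sum>i=1..h. ?X i ^ e * (1 / ?X i)))"
    unfolding poly_altdef_le[OF degree_h_poly] sum_distrib_right sum_distrib_left
    by (subst sum.swap) (simp add: mult.assoc)
  also have "\<dots> \<cong>\<^bsub>1\<^esub> (\<Sum>e\<le>h. Polynomial.coeff h_poly e * (if e = 1 then of_nat h else 0))"
    by (intro pcong_sum pcong_mult_left0 pow coeff_h_poly_in_I) auto
  also have "\<dots> = (\<Sum>e\<le>h. if e = 1 then Polynomial.coeff h_poly 1 * of_nat h else 0)"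
    by (intro sum.cong refl) auto
  also have "\<dots> = Polynomial.coeff h_poly 1 * of_nat h"
    using h_less by simp
  finally have "- 2 * hconv h / of_nat 4 \<cong>\<^bsub>1\<^esub> Polynomial.coeff h_poly 1 * of_nat h"
    using pcong_trans[OF pcong_sym[OF lhs]] by blast
  \<comment> \<open>The factor -2 turns h into -2h = 1 - p, which is 1 modulo p.\<close>
  then have "- 2 * (- 2 * hconv h / of_nat 4) \<cong>\<^bsub>1\<^esub> - 2 * (Polynomial.coeff h_poly 1 * of_nat h)"
    by (rule pcong_mult_left0) (intro I_minus I_numeral)
  then have "hconv h \<cong>\<^bsub>1\<^esub> - (2 * of_nat h) * Polynomial.coeff h_poly 1"
    by (simp add: mult_ac)
  also have "- (2 * of_nat h) = (1 - of_nat p :: rat)"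
    using arg_cong[OF p_eq, of "of_nat :: nat \<Rightarrow> rat"] by (simp add: h_def del: of_nat_mult)
  also have "(1 - of_nat p) * Polynomial.coeff h_poly 1 \<cong>\<^bsub>1\<^esub> Polynomial.coeff h_poly 1"
    using p_mult_in_I[OF coeff_h_poly_in_I, of 1] by (simp add: pcong_def algebra_simps I_minus)
  finally show ?thesis by (rule pcong_sym)
qed

text \<open>For k < p the coefficients are p-integral, so at X = p^2 all terms from X^2 on lie in
  \<open>I 4\<close>.\<close>

lemma phi_diff_1_pcong:
  assumes "k < p"
  shows "phi_diff 1 k \<cong>\<^bsub>4\<^esub> - (of_nat p ^ 2) * Polynomial.coeff (phi_poly k) 1"
proof -
  let ?c = "Polynomial.coeff (phi_poly k)"
  have deg: "degree (phi_poly k) \<le> Suc (Suc k)"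
    using degree_phi_poly[of k] by simp
  have split: "phi X k = ?c 0 + ?c 1 * X + (\<Sum>e\<le>k. ?c (Suc (Suc e)) * X ^ Suc (Suc e))" for X
    unfolding poly_phi_poly[symmetric] poly_altdef_le[OF deg] by (simp add: sum.atMost_Suc_shift del: sum.atMost_Suc)
  have "phi_diff 1 k - - (of_nat p ^ 2) * ?c 1 = - (\<Sum>e\<le>k. ?c (Suc (Suc e)) * (of_nat p ^ 2) ^ Suc (Suc e))"
    unfolding phi_diff_def split by simp
  also have "\<dots> \<in> I 4"
  proof (intro I_minus I_sum I_mult_0 coeff_phi_poly_in_I assms)
    fix e
    show "(of_nat p ^ 2) ^ Suc (Suc e) \<in> I 4"
      unfolding power_mult[symmetric] by (rule p_power_in_I) simp
  qed
  finally show ?thesis by (simp only: pcong_def)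
qed

lemma error_term_1: "2 * error_term 1 \<cong>\<^bsub>4\<^esub> of_nat p ^ 3 * hconv h"
proof -
  let ?P = "of_nat p :: rat"
  have "2 * error_term 1 = (\<Sum>k\<le>h. 2 * (weight 1 k * phi_diff 1 k))"
    unfolding error_term_def h_def[symmetric] by (rule sum_distrib_left)
  \<comment> \<open>The index 0, where the weight is not divisible by p, drops out because
    \<open>phi_diff 1 0\<close> is 0.\<close>
  also have "\<dots> = (\<Sum>k=1..h. 2 * (weight 1 k * phi_diff 1 k))"
    by (intro sum.mono_neutral_right) (auto simp: phi_diff_def not_le)
  also have "\<dots> \<cong>\<^bsub>4\<^esub> (\<Sum>k=1..h. ?P ^ 3 * (Polynomial.coeff (phi_poly k) 1 / of_nat k))"
  proof (rule pcong_sum)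
    fix k assume k: "k \<in> {1..h}"
    have kp: "0 < k" "k < p" "0 < p - 2 * k" "p - 2 * k < p" "k \<le> half 1" "2 * k \<le> p"
      using k h_less by (auto simp: h_def)
    have c: "Polynomial.coeff (phi_poly k) 1 \<in> I 0" using kp by (intro coeff_phi_poly_in_I)
    \<comment> \<open>The exact remainder of p/(p-2k) after its first-order term -p/(2k), both
      doubled. Precision p^2 is enough, since the other factor contributes p^2.\<close>
    have "2 * weight 1 k - - (?P / of_nat k) = ?P ^ 2 / of_nat k ^ 1 / of_nat (p - 2 * k) ^ 1"
    proof -
      define x d :: rat where "x = of_nat k" and "d = of_nat (p - 2 * k)"
      have nz: "x \<noteq> 0" "d \<noteq> 0" using kp by (simp_all add: x_def d_def del: of_nat_diff)
      have d: "?P - 2 * x = d" using kp by (simp add: x_def d_def of_nat_diff)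
      have "2 * (?P / d) - - (?P / x) = ?P * (d + 2 * x) / x / d"
        using nz by (simp add: divide_simps) (simp add: algebra_simps)
      also have "d + 2 * x = ?P" by (simp flip: d)
      finally show ?thesis
        unfolding weight_def power_one_right x_def[symmetric] d d_def[symmetric] power2_eq_square by simp
    qed
    moreover have "?P ^ 2 / of_nat k ^ 1 / of_nat (p - 2 * k) ^ 1 \<in> I 2"
      using kp by (intro I_divide_power p_power_in_I) auto
    ultimately have w: "2 * weight 1 k \<cong>\<^bsub>2\<^esub> - (?P / of_nat k)"
      by (simp only: pcong_def)
    have "2 * (weight 1 k * phi_diff 1 k) = (2 * weight 1 k) * phi_diff 1 k" by simp
    also have "\<dots> \<cong>\<^bsub>4\<^esub> (2 * weight 1 k) * (- (?P ^ 2) * Polynomial.coeff (phi_poly k) 1)"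
      using kp by (intro pcong_mult_left0 phi_diff_1_pcong I_mult_0 I_numeral weight_in_I)
    also have "\<dots> = (- (?P ^ 2) * Polynomial.coeff (phi_poly k) 1) * (2 * weight 1 k)" by simp
    also have "\<dots> \<cong>\<^bsub>4\<^esub> (- (?P ^ 2) * Polynomial.coeff (phi_poly k) 1) * - (?P / of_nat k)"
      using pcong_mult_left[OF w, of "- (?P ^ 2) * Polynomial.coeff (phi_poly k) 1" 2] c I_p_power[of 2]
      by (simp add: I_minus I_mult_0')
    also have "\<dots> = ?P ^ 3 * (Polynomial.coeff (phi_poly k) 1 / of_nat k)"
      by (simp add: power2_eq_square power3_eq_cube)
    finally show "2 * (weight 1 k * phi_diff 1 k) \<cong>\<^bsub>4\<^esub> ?P ^ 3 * (Polynomial.coeff (phi_poly k) 1 / of_nat k)" .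
  qed
  also have "\<dots> = ?P ^ 3 * Polynomial.coeff h_poly 1"
    by (simp add: coeff_h_poly sum_distrib_left)
  also have "\<dots> \<cong>\<^bsub>4\<^esub> ?P ^ 3 * hconv h"
    using pcong_mult_left[OF coeff_1_h_poly I_p_power[of 3]] by simp
  finally show ?thesis .
qed

lemma hconv_in_I: "hconv h \<in> I 0"
  unfolding hconv_def using h_less by (intro I_sum I_divide_power hs_in_I) auto

lemma error_term_1_in_I: "error_term 1 \<in> I 3"
proof -
  have "of_nat p ^ 3 * hconv h \<in> I 3"
    by (intro I_mult_0' I_p_power hconv_in_I)
  moreover have "2 * error_term 1 \<cong>\<^bsub>3\<^esub> of_nat p ^ 3 * hconv h"
    using error_term_1 by (rule pcong_antimono) simp
  ultimately have "2 * error_term 1 \<in> I 3" using pcong_I by blast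
  then show ?thesis using I_divide_nat[OF _ not_dvd_2, of "2 * error_term 1" 3] by simp
qed

text \<open>To first order the product is 1 - p^2/4 times \<open>hs 2 h\<close>; 24 clears this 4
  and supplies the 6 of \<open>hs_2_half\<close>.\<close>

lemma main_term_1: "24 * main_term 1 \<cong>\<^bsub>4\<^esub> 24 + 7 * of_nat p ^ 3 * hs 3 h"
proof -
  let ?P = "of_nat p :: rat"
  have "main_term 1 \<cong>\<^bsub>2 * 2\<^esub> 1 - (\<Sum>j=1..h. (?P / (2 * of_nat j))\<^sup>2)"
    unfolding main_term_def h_def[symmetric] power_one_right
  proof (rule pcong_prod_one_minus)
    fix j assume "j \<in> {1..h}"
    then have "?P / of_nat (2 * j) ^ 1 \<in> I 1"
      using h_less by (intro I_divide_power p_in_I_1) auto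
    then show "(?P / (2 * of_nat j))\<^sup>2 \<in> I 2"
      using I_power[of "?P / (2 * of_nat j)" 1 2] by simp
  qed
  also have "(\<Sum>j=1..h. (?P / (2 * of_nat j))\<^sup>2) = ?P ^ 2 * hs 2 h / 4"
    by (simp add: hs_def sum_distrib_left sum_divide_distrib power_divide power_mult_distrib mult.commute)
  finally have "24 * main_term 1 \<cong>\<^bsub>4\<^esub> 24 * (1 - (?P ^ 2) * hs 2 h / 4)"
    by (intro pcong_mult_left0) simp_all
  also have "\<dots> = 24 - ?P ^ 2 * (6 * hs 2 h)" by (simp add: algebra_simps)
  also have "\<dots> \<cong>\<^bsub>4\<^esub> 24 - ?P ^ 2 * (- 7 * ?P * hs 3 h)"
    using pcong_mult_left[OF hs_2_half I_p_power[of 2]] by (intro pcong_diff) auto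
  also have "\<dots> = 24 + 7 * ?P ^ 3 * hs 3 h"
    by (simp add: power2_eq_square power3_eq_cube)
  finally show ?thesis .
qed

lemma main_error_term_1: "main_term 1 + error_term 1 \<cong>\<^bsub>4\<^esub> 1 + 7 / 6 * of_nat p ^ 3 * bernoulli (p - 3)"
proof -
  let ?P = "of_nat p :: rat" and ?B = "bernoulli (p - 3)"
  have "24 * main_term 1 + 12 * (2 * error_term 1) \<cong>\<^bsub>4\<^esub> (24 + ?P ^ 3 * (7 * hs 3 h)) + 12 * (?P ^ 3 * hconv h)"
    using main_term_1 error_term_1 by (intro pcong_add pcong_mult_left0) (simp_all add: mult_ac)
  also have "\<dots> = 24 + ?P ^ 3 * (7 * hs 3 h + 6 * (2 * hconv h))"
    by (simp add: algebra_simps)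
  also have "\<dots> \<cong>\<^bsub>4\<^esub> 24 + ?P ^ 3 * (7 * (- 2 * ?B) + 6 * (7 * ?B))"
  proof (rule pcong_add)
    have "7 * hs 3 h + 6 * (2 * hconv h) \<cong>\<^bsub>1\<^esub> 7 * (- 2 * ?B) + 6 * (7 * ?B)"
      by (intro pcong_add pcong_mult_left0 hs_3_half hconv_half I_numeral)
    from pcong_mult_left[OF this I_p_power[of 3]]
    show "?P ^ 3 * (7 * hs 3 h + 6 * (2 * hconv h)) \<cong>\<^bsub>4\<^esub> ?P ^ 3 * (7 * (- 2 * ?B) + 6 * (7 * ?B))"
      by simp
  qed simp
  \<comment> \<open>-14 + 42 = 28, and 28/24 = 7/6.\<close>
  finally have "of_nat 24 * (main_term 1 + error_term 1) \<cong>\<^bsub>4\<^esub> of_nat 24 * (1 + 7 / 6 * ?P ^ 3 * ?B)"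
    by (simp add: algebra_simps)
  moreover have "\<not> p dvd 24"
    using not_dvd_mult[OF not_dvd_mult[OF not_dvd_2 not_dvd_2] not_dvd_6] by simp
  ultimately show ?thesis by (rule pcong_cancel_nat)
qed

end

theorem theorem1p2:
  fixes p r :: nat
  assumes "prime p" and "p > 3" and "r \<ge> 1"
  shows "qcong
     (\<Sum>k = 0..(p ^ r - 1) div 2.
        of_nat (4 * k + 1) * (pochhammer (1/2 :: rat) k) ^ 4 / (pochhammer (1 :: rat) k) ^ 4)
     (of_nat (p ^ r) + 7 / 6 * of_nat (p ^ (r + 3)) * bernoulli (p - 3))
     p (r + 4)"
proof -
  interpret prime_gt_3 p by standard fact+
  have "(\<Sum>k = 0..(p ^ r - 1) div 2.
        of_nat (4 * k + 1) * (pochhammer (1/2 :: rat) k) ^ 4 / (pochhammer (1 :: rat) k) ^ 4)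
      = (\<Sum>k\<le>half r. of_nat (4 * k + 1) * (phi 0 k)\<^sup>2)"
    unfolding times_divide_eq_right[symmetric] pochhammer_power4 half_def atLeast0AtMost ..
  also have "\<dots> \<cong>\<^bsub>r + 4\<^esub> of_nat (p ^ r) * (main_term 1 + error_term 1)"
    using assms(3) error_term_1_in_I by (rule sum_pcong_level_1)
  also have "\<dots> \<cong>\<^bsub>r + 4\<^esub> of_nat (p ^ r) * (1 + 7 / 6 * of_nat p ^ 3 * bernoulli (p - 3))"
    using pcong_mult_left[OF main_error_term_1 I_p_power[of r]] by (simp add: add.commute)
  also have "\<dots> = of_nat (p ^ r) + 7 / 6 * of_nat (p ^ (r + 3)) * bernoulli (p - 3)"
    by (simp add: power_add algebra_simps)
  finally show ?thesis by (simp only: qcong_iff)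
qed

end
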